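(* Assume the standing setting described in the context, and let $L:=\{\ell\in I: C(A_\ell)=\infty\}$, assumed nonempty and contained in $I^-$. Let $\tilde{\boldsymbol\lambda}=(\tilde\lambda^i)_{i\in I}$ be a solution of the $(\boldsymbol A,\boldsymbol a,g,\chi,I\setminus L)$-problem, and suppose that $$a_\ell\ge\int g\,d\tilde\lambda^\ell\quad\text{for all }\ell\in L.$$ Then $G_\chi(\boldsymbol A,\boldsymbol a,g)=G_\chi(\boldsymbol A,\boldsymbol a,g,I\setminus L)$, and the Gauss variational problem (the $(\boldsymbol A,\boldsymbol a,g,\chi,I)$-problem) is solvable if and only if $a_\ell=\int g\,d\tilde\lambda^\ell$ for all $\ell\in L$.
   Context: Standing setting. $\mathrm X$ is a noncompact locally compact Hausdorff space; $\mathfrak M$ is the space of real Radon measures on $\mathrm X$ with the vague topology; $S(\nu)$ is the support of $\nu$; $\nu$ is bounded if $|\nu|(\mathrm X)<\infty$. The kernel $\kappa:\mathrm X\times\mathrm X\to[0,\infty]$ is lower semicontinuous and symmetric; $\kappa(\nu,\nu_1)=\int\kappa\,d(\nu\otimes\nu_1)$, $\kappa(x,\nu)=\int\kappa(x,y)\,d\nu(y)$; $\mathcal E$ is the set of $\nu\in\mathfrak M$ with $\kappa(\nu,\nu)$ well defined and finite. Assumed: (a) $\kappa$ strictly positive definite ($\kappa(\nu,\nu)\ge0$ whenever defined and $\|\nu\|:=\kappa(\nu,\nu)^{1/2}$ is a norm on the pre-Hilbert space $\mathcal E$; "strong" refers to this norm); (b) consistent: every strong Cauchy net in $\mathcal E^+:=\{\nu\in\mathcal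 E:\nu\ge0\}$ converges strongly to each of its vague cluster points; (c) $\kappa(x,y)$ finite and continuous for $x\ne y$; (d) for every $\varepsilon>0$ and compact $K$ there is a compact $K'$ with $\kappa(x,y)<\varepsilon$ for $x\in K$, $y\notin K'$; (e) generalized maximum principle with constant $h\ge1$: for compactly supported $\nu\ge0$ with $M:=\sup_{S(\nu)}\kappa(\cdot,\nu)<\infty$, $\kappa(\cdot,\nu)\le hM$ on $\mathrm X$. $\mathcal E^+_E$: elements of $\mathcal E^+$ concentrated on $E$ (complement locally negligible). Interior capacity $C(E)=1/\inf\{\kappa(\nu,\nu):\nu\in\mathcal E^+_E,\nu(E)=1\}$; "n.e." = except on a set of interior capacity zero. Condenser: disjoint countable index sets $I^+,I^-$ ($I^-$ possibly empty), $I=I^+\cup I^-$; nonempty closed $A_i\subset\mathrm X$, every compact set meets finitely many $A_i$, $A_i\cap A_j=\varnothing$ for $i\in I^+,j\in I^-$; $\alpha_i=\pm1$ for $i\in I^\pm$; $A^\pm=\bigcup_{i\in I^\pm}A_i$, $A=\bigcup_iA_i$; $\sup_{A^+\times A^-}\kappa<\infty$. Vector measures $\boldsymbol\mu=(\mu^i)_{i\in I}$, $\mu^i\ge0$ concentrated on $A_i$; $R\boldsymbol\mu=\sum_i\alpha_i\mu^i$; energy $\kappa(\boldsymbol\mu,\boldsymbol\mu)=\sum_{i,j}\alpha_i\alpha_j\kappa(\mu^i,\mu^j)$; $\mathcal E^+(\boldsymbol A)$ = vector measures of finite energy. External field: bounded signed $\chi\in\mathcal E$ with $S(\chi^+)\cap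 A^-=\varnothing$, $S(\chi^-)\cap A^+=\varnothing$; $G_\chi(\boldsymbol\mu):=\|R\boldsymbol\mu\|^2+2\kappa(\chi,R\boldsymbol\mu)$ $(=\kappa(\boldsymbol\mu,\boldsymbol\mu)+2\sum_i\alpha_i\int\kappa(x,\chi)d\mu^i(x))$. $g$ continuous on $A$, $g_{\inf}:=\inf_Ag>0$, and for each $i$ either $g|_{A_i}$ bounded or $g^{r_i}\le\kappa(\cdot,\nu_i)$ n.e. on $A_i$ for some $r_i>1$, $\nu_i\in\mathcal E$. $\boldsymbol a=(a_i)$, $a_i>0$, $\sum_ia_i<\infty$. For $I^+\subseteq J\subseteq I$: $\mathcal E^+(\boldsymbol A,\boldsymbol a,g,J)=\{\boldsymbol\mu\in\mathcal E^+(\boldsymbol A):\int g\,d\mu^i=a_i\ \forall i\in J\}$; $G_\chi(\boldsymbol A,\boldsymbol a,g,J)$ is the infimum of $G_\chi$ over it; the $(\boldsymbol A,\boldsymbol a,g,\chi,J)$-problem asks for a minimizer in this class. For $J=I$ the symbol $J$ is dropped and the problem is the Gauss variational problem. It is assumed that $G_\chi(\boldsymbol A,\boldsymbol a,g)<\infty$. *)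

theory Defs
  imports "HOL-Analysis.Analysis"
begin

definition radon :: "'a::topological_space measure \<Rightarrow> bool" where
  "radon \<mu> \<longleftrightarrow> sets \<mu> = sets borel \<and>
     (\<forall>K. compact K \<longrightarrow> emeasure \<mu> K < \<infinity>) \<and>
     (\<forall>U. open U \<longrightarrow> emeasure \<mu> U = (SUP K\<in>{K. compact K \<and> K \<subseteq> U}. emeasure \<mu> K)) \<and>
     (\<forall>B\<in>sets borel. emeasure \<mu> B = (INF U\<in>{U. open U \<and> B \<subseteq> U}. emeasure \<mu> U))"

definition support :: "'a::topological_space measure \<Rightarrow> 'a set" where
  "support \<mu> = {x. \<forall>U. open U \<longrightarrow> x \<in> U \<longrightarrow> emeasure \<mu> U > 0}"

definition concentrated :: "'a::topological_space measure \<Rightarrow> 'a set \<Rightarrow> bool" where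
  "concentrated \<mu> E \<longleftrightarrow>
     (\<forall>K. compact K \<longrightarrow> (\<exists>N\<in>sets borel. K - E \<subseteq> N \<and> emeasure \<mu> N = 0))"

text \<open>Real signed Radon measures, represented by their Jordan decomposition
\<open>(\<nu>\<^sup>+, \<nu>\<^sup>-)\<close>: a pair of mutually singular positive Radon measures.\<close>
definition signed_radon :: "'a::topological_space measure \<times> 'a measure \<Rightarrow> bool" where
  "signed_radon \<nu> \<longleftrightarrow> radon (fst \<nu>) \<and> radon (snd \<nu>) \<and>
     (\<exists>S\<in>sets borel. emeasure (fst \<nu>) (UNIV - S) = 0 \<and> emeasure (snd \<nu>) S = 0)"

definition bounded_signed :: "'a::topological_space measure \<times> 'a measure \<Rightarrow> bool" where
  "bounded_signed \<nu> \<longleftrightarrow> emeasure (fst \<nu>) UNIV < \<infinity> \<and> emeasure (snd \<nu>) UNIV < \<infinity>"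

definition compactly_supported_cont :: "('a::topological_space \<Rightarrow> real) \<Rightarrow> bool" where
  "compactly_supported_cont f \<longleftrightarrow> continuous_on UNIV f \<and> compact (closure {x. f x \<noteq> 0})"

definition pot :: "('a \<Rightarrow> 'a \<Rightarrow> ennreal) \<Rightarrow> 'a measure \<Rightarrow> 'a \<Rightarrow> ennreal" where
  "pot \<kappa> \<mu> x = (\<integral>\<^sup>+ y. \<kappa> x y \<partial>\<mu>)"

text \<open>Mutual energy \<open>\<kappa>(\<mu>,\<nu>) = \<integral>\<kappa> d(\<mu>\<otimes>\<nu>)\<close> of positive Radon measures, written as
the iterated integral (Fubini for lower semicontinuous \<open>\<kappa> \<ge> 0\<close>).\<close>
definition kap :: "('a \<Rightarrow> 'a \<Rightarrow> ennreal) \<Rightarrow> 'a measure \<Rightarrow> 'a measure \<Rightarrow> ennreal" where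
  "kap \<kappa> \<mu> \<nu> = (\<integral>\<^sup>+ x. pot \<kappa> \<nu> x \<partial>\<mu>)"

definition sen_pos :: "('a \<Rightarrow> 'a \<Rightarrow> ennreal) \<Rightarrow> 'a measure \<times> 'a measure \<Rightarrow> ennreal" where
  "sen_pos \<kappa> \<nu> = kap \<kappa> (fst \<nu>) (fst \<nu>) + kap \<kappa> (snd \<nu>) (snd \<nu>)"

definition sen_neg :: "('a \<Rightarrow> 'a \<Rightarrow> ennreal) \<Rightarrow> 'a measure \<times> 'a measure \<Rightarrow> ennreal" where
  "sen_neg \<kappa> \<nu> = 2 * kap \<kappa> (fst \<nu>) (snd \<nu>)"

definition energy_wd :: "('a \<Rightarrow> 'a \<Rightarrow> ennreal) \<Rightarrow> 'a measure \<times> 'a measure \<Rightarrow> bool" where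
  "energy_wd \<kappa> \<nu> \<longleftrightarrow> sen_pos \<kappa> \<nu> < \<infinity> \<or> sen_neg \<kappa> \<nu> < \<infinity>"

definition senergy :: "('a \<Rightarrow> 'a \<Rightarrow> ennreal) \<Rightarrow> 'a measure \<times> 'a measure \<Rightarrow> ereal" where
  "senergy \<kappa> \<nu> = enn2ereal (sen_pos \<kappa> \<nu>) - enn2ereal (sen_neg \<kappa> \<nu>)"

definition Ecal :: "('a::topological_space \<Rightarrow> 'a \<Rightarrow> ennreal) \<Rightarrow> ('a measure \<times> 'a measure) set" where
  "Ecal \<kappa> = {\<nu>. signed_radon \<nu> \<and> energy_wd \<kappa> \<nu> \<and> senergy \<kappa> \<nu> \<noteq> \<infinity> \<and> senergy \<kappa> \<nu> \<noteq> -\<infinity>}"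

definition Epos :: "('a::topological_space \<Rightarrow> 'a \<Rightarrow> ennreal) \<Rightarrow> 'a measure set" where
  "Epos \<kappa> = {\<mu>. radon \<mu> \<and> kap \<kappa> \<mu> \<mu> < \<infinity>}"

definition Epos_on :: "('a::topological_space \<Rightarrow> 'a \<Rightarrow> ennreal) \<Rightarrow> 'a set \<Rightarrow> 'a measure set" where
  "Epos_on \<kappa> E = {\<mu>\<in>Epos \<kappa>. concentrated \<mu> E}"

definition sdist2 :: "('a \<Rightarrow> 'a \<Rightarrow> ennreal) \<Rightarrow> 'a measure \<Rightarrow> 'a measure \<Rightarrow> real" where
  "sdist2 \<kappa> \<mu> \<nu> = enn2real (kap \<kappa> \<mu> \<mu>) + enn2real (kap \<kappa> \<nu> \<nu>) - 2 * enn2real (kap \<kappa> \<mu> \<nu>)"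

text \<open>Interior capacity \<open>C(E) = 1 / inf {\<kappa>(\<nu>,\<nu>) : \<nu> \<in> \<E>\<^sup>+_E, \<nu>(E) = 1}\<close>
(with \<open>1/0 = \<infinity>\<close>, \<open>1/\<infinity> = 0\<close>). Since \<open>\<nu>\<close> is concentrated on \<open>E\<close>,
\<open>\<nu>(E)\<close> is the total mass of \<open>\<nu>\<close>.\<close>
definition capacity :: "('a::topological_space \<Rightarrow> 'a \<Rightarrow> ennreal) \<Rightarrow> 'a set \<Rightarrow> ennreal" where
  "capacity \<kappa> E = 1 / (INF \<nu>\<in>{\<nu>\<in>Epos_on \<kappa> E. emeasure \<nu> UNIV = 1}. kap \<kappa> \<nu> \<nu>)"

definition nearly_everywhere ::
    "('a::topological_space \<Rightarrow> 'a \<Rightarrow> ennreal) \<Rightarrow> 'a set \<Rightarrow> ('a \<Rightarrow> bool) \<Rightarrow> bool" where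
  "nearly_everywhere \<kappa> E P \<longleftrightarrow> capacity \<kappa> {x\<in>E. \<not> P x} = 0"

definition kernel_lsc :: "('a::topological_space \<Rightarrow> 'a \<Rightarrow> ennreal) \<Rightarrow> bool" where
  "kernel_lsc \<kappa> \<longleftrightarrow> (\<forall>t. open {z. t < \<kappa> (fst z) (snd z)})"

definition kernel_symmetric :: "('a \<Rightarrow> 'a \<Rightarrow> ennreal) \<Rightarrow> bool" where
  "kernel_symmetric \<kappa> \<longleftrightarrow> (\<forall>x y. \<kappa> x y = \<kappa> y x)"

definition strictly_pos_def :: "('a::topological_space \<Rightarrow> 'a \<Rightarrow> ennreal) \<Rightarrow> bool" where
  "strictly_pos_def \<kappa> \<longleftrightarrow>
     (\<forall>\<nu>. signed_radon \<nu> \<and> energy_wd \<kappa> \<nu> \<longrightarrow> senergy \<kappa> \<nu> \<ge> 0) \<and>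
     (\<forall>\<nu>\<in>Ecal \<kappa>. senergy \<kappa> \<nu> = 0 \<longrightarrow> (\<forall>B. emeasure (fst \<nu>) B = 0 \<and> emeasure (snd \<nu>) B = 0))"

text \<open>(b) consistency. A net in \<open>\<E>\<^sup>+\<close> is represented by its (proper) image filter \<open>F\<close>
on measures.  Vague cluster point: every basic vague neighbourhood (given by finitely
many \<open>f \<in> C\<^sub>0(X)\<close> and \<open>\<epsilon> > 0\<close>) is visited frequently.\<close>
definition vague_cluster_point :: "'a::topological_space measure filter \<Rightarrow> 'a measure \<Rightarrow> bool" where
  "vague_cluster_point F \<nu> \<longleftrightarrow>
     (\<forall>fs \<epsilon>. finite fs \<longrightarrow> (\<forall>f\<in>fs. compactly_supported_cont f) \<longrightarrow> \<epsilon> > 0 \<longrightarrow>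
        (\<exists>\<^sub>F \<mu> in F. \<forall>f\<in>fs. \<bar>integral\<^sup>L \<mu> f - integral\<^sup>L \<nu> f\<bar> < \<epsilon>))"

definition consistent_kernel :: "('a::topological_space \<Rightarrow> 'a \<Rightarrow> ennreal) \<Rightarrow> bool" where
  "consistent_kernel \<kappa> \<longleftrightarrow>
     (\<forall>F. F \<noteq> bot \<longrightarrow> (\<forall>\<^sub>F \<mu> in F. \<mu> \<in> Epos \<kappa>) \<longrightarrow>
        (\<forall>\<epsilon>>0. \<forall>\<^sub>F p in F \<times>\<^sub>F F. sdist2 \<kappa> (fst p) (snd p) < \<epsilon>) \<longrightarrow>
        (\<forall>\<nu>. radon \<nu> \<longrightarrow> vague_cluster_point F \<nu> \<longrightarrow>
           \<nu> \<in> Epos \<kappa> \<and> ((\<lambda>\<mu>. sdist2 \<kappa> \<mu> \<nu>) \<longlongrightarrow> 0) F))"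

definition kernel_offdiag_cont :: "('a::topological_space \<Rightarrow> 'a \<Rightarrow> ennreal) \<Rightarrow> bool" where
  "kernel_offdiag_cont \<kappa> \<longleftrightarrow> (\<forall>x y. x \<noteq> y \<longrightarrow> \<kappa> x y < \<infinity>) \<and>
     continuous_on {z. fst z \<noteq> snd z} (\<lambda>z. \<kappa> (fst z) (snd z))"

definition kernel_vanish_infty :: "('a::topological_space \<Rightarrow> 'a \<Rightarrow> ennreal) \<Rightarrow> bool" where
  "kernel_vanish_infty \<kappa> \<longleftrightarrow>
     (\<forall>\<epsilon>::real. \<epsilon> > 0 \<longrightarrow> (\<forall>K. compact K \<longrightarrow>
        (\<exists>K'. compact K' \<and> (\<forall>x\<in>K. \<forall>y. y \<notin> K' \<longrightarrow> \<kappa> x y < ennreal \<epsilon>))))"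

definition gen_max_principle :: "('a::topological_space \<Rightarrow> 'a \<Rightarrow> ennreal) \<Rightarrow> real \<Rightarrow> bool" where
  "gen_max_principle \<kappa> h \<longleftrightarrow>
     (\<forall>\<nu>. radon \<nu> \<longrightarrow> compact (support \<nu>) \<longrightarrow>
        (SUP x\<in>support \<nu>. pot \<kappa> \<nu> x) < \<infinity> \<longrightarrow>
        (\<forall>x. pot \<kappa> \<nu> x \<le> ennreal h * (SUP x\<in>support \<nu>. pot \<kappa> \<nu> x)))"

definition condenser :: "('a::topological_space \<Rightarrow> 'a \<Rightarrow> ennreal) \<Rightarrow> nat set \<Rightarrow> nat set \<Rightarrow> (nat \<Rightarrow> 'a set) \<Rightarrow> bool" where
  "condenser \<kappa> Ipos Ineg A \<longleftrightarrow> Ipos \<inter> Ineg = {} \<and>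
     (\<forall>i\<in>Ipos \<union> Ineg. A i \<noteq> {} \<and> closed (A i)) \<and>
     (\<forall>K. compact K \<longrightarrow> finite {i\<in>Ipos \<union> Ineg. A i \<inter> K \<noteq> {}}) \<and>
     (\<forall>i\<in>Ipos. \<forall>j\<in>Ineg. A i \<inter> A j = {}) \<and>
     (SUP z\<in>(\<Union>i\<in>Ipos. A i) \<times> (\<Union>j\<in>Ineg. A j). \<kappa> (fst z) (snd z)) < \<infinity>"

definition sum_measure :: "(nat \<Rightarrow> 'a::topological_space measure) \<Rightarrow> nat set \<Rightarrow> 'a measure" where
  "sum_measure \<mu> S = measure_of UNIV (sets borel) (\<lambda>B. \<Sum>i. (if i \<in> S then emeasure (\<mu> i) B else 0))"

text \<open>\<open>R\<mu> = \<Sum>\<^sub>i \<alpha>\<^sub>i \<mu>\<^sup>i\<close> as a signed measure (positive part over \<open>I\<^sup>+\<close>, negative over \<open>I\<^sup>-\<close>).\<close>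
definition Rvec :: "nat set \<Rightarrow> nat set \<Rightarrow> (nat \<Rightarrow> 'a::topological_space measure) \<Rightarrow> 'a measure \<times> 'a measure" where
  "Rvec Ipos Ineg \<mu> = (sum_measure \<mu> Ipos, sum_measure \<mu> Ineg)"

text \<open>\<open>\<E>\<^sup>+(A)\<close>: vector measures with \<open>\<mu>\<^sup>i \<ge> 0\<close> Radon, concentrated on \<open>A\<^sub>i\<close>, and finite energy
\<open>\<Sum>\<^sub>i\<^sub>,\<^sub>j \<alpha>\<^sub>i\<alpha>\<^sub>j\<kappa>(\<mu>\<^sup>i,\<mu>\<^sup>j)\<close> (well defined and finite iff \<open>\<Sum>\<^sub>i\<^sub>,\<^sub>j \<kappa>(\<mu>\<^sup>i,\<mu>\<^sup>j) < \<infinity>\<close>).\<close>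
definition Evec :: "('a::topological_space \<Rightarrow> 'a \<Rightarrow> ennreal) \<Rightarrow> nat set \<Rightarrow> nat set \<Rightarrow> (nat \<Rightarrow> 'a set)
    \<Rightarrow> (nat \<Rightarrow> 'a measure) set" where
  "Evec \<kappa> Ipos Ineg A = {\<mu>. (\<forall>i\<in>Ipos \<union> Ineg. radon (\<mu> i) \<and> concentrated (\<mu> i) (A i)) \<and>
      (\<Sum>i. \<Sum>j. (if i \<in> Ipos \<union> Ineg \<and> j \<in> Ipos \<union> Ineg then kap \<kappa> (\<mu> i) (\<mu> j) else 0)) < \<infinity>}"

text \<open>\<open>\<kappa>(\<nu>,\<sigma>)\<close> for signed \<open>\<nu>,\<sigma> \<in> \<E>\<close> (all four mutual energies are finite there).\<close>
definition skap :: "('a \<Rightarrow> 'a \<Rightarrow> ennreal) \<Rightarrow> 'a measure \<times> 'a measure \<Rightarrow> 'a measure \<times> 'a measure \<Rightarrow> real" where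
  "skap \<kappa> \<nu> \<sigma> = enn2real (kap \<kappa> (fst \<nu>) (fst \<sigma>)) + enn2real (kap \<kappa> (snd \<nu>) (snd \<sigma>))
       - enn2real (kap \<kappa> (fst \<nu>) (snd \<sigma>)) - enn2real (kap \<kappa> (snd \<nu>) (fst \<sigma>))"

definition Gchi :: "('a::topological_space \<Rightarrow> 'a \<Rightarrow> ennreal) \<Rightarrow> nat set \<Rightarrow> nat set \<Rightarrow> 'a measure \<times> 'a measure
    \<Rightarrow> (nat \<Rightarrow> 'a measure) \<Rightarrow> real" where
  "Gchi \<kappa> Ipos Ineg chi \<mu> = skap \<kappa> (Rvec Ipos Ineg \<mu>) (Rvec Ipos Ineg \<mu>) + 2 * skap \<kappa> chi (Rvec Ipos Ineg \<mu>)"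

definition Eadm :: "('a::topological_space \<Rightarrow> 'a \<Rightarrow> ennreal) \<Rightarrow> nat set \<Rightarrow> nat set \<Rightarrow> (nat \<Rightarrow> 'a set)
    \<Rightarrow> (nat \<Rightarrow> real) \<Rightarrow> ('a \<Rightarrow> real) \<Rightarrow> nat set \<Rightarrow> (nat \<Rightarrow> 'a measure) set" where
  "Eadm \<kappa> Ipos Ineg A a g J = {\<mu>\<in>Evec \<kappa> Ipos Ineg A. \<forall>i\<in>J. (\<integral>\<^sup>+ x\<in>A i. ennreal (g x) \<partial>\<mu> i) = ennreal (a i)}"

text \<open>\<open>G\<^sub>\<chi>(A,a,g,J)\<close> (infimum over the empty class is \<open>+\<infinity>\<close>).\<close>
definition Ginf :: "('a::topological_space \<Rightarrow> 'a \<Rightarrow> ennreal) \<Rightarrow> nat set \<Rightarrow> nat set \<Rightarrow> (nat \<Rightarrow> 'a set)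
    \<Rightarrow> (nat \<Rightarrow> real) \<Rightarrow> ('a \<Rightarrow> real) \<Rightarrow> 'a measure \<times> 'a measure \<Rightarrow> nat set \<Rightarrow> ereal" where
  "Ginf \<kappa> Ipos Ineg A a g chi J = (INF \<mu>\<in>Eadm \<kappa> Ipos Ineg A a g J. ereal (Gchi \<kappa> Ipos Ineg chi \<mu>))"

definition is_solution :: "('a::topological_space \<Rightarrow> 'a \<Rightarrow> ennreal) \<Rightarrow> nat set \<Rightarrow> nat set \<Rightarrow> (nat \<Rightarrow> 'a set)
    \<Rightarrow> (nat \<Rightarrow> real) \<Rightarrow> ('a \<Rightarrow> real) \<Rightarrow> 'a measure \<times> 'a measure \<Rightarrow> nat set \<Rightarrow> (nat \<Rightarrow> 'a measure) \<Rightarrow> bool" where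
  "is_solution \<kappa> Ipos Ineg A a g chi J lam \<longleftrightarrow>
     lam \<in> Eadm \<kappa> Ipos Ineg A a g J \<and> ereal (Gchi \<kappa> Ipos Ineg chi lam) = Ginf \<kappa> Ipos Ineg A a g chi J"

end

theory Submission
  imports Defs
begin

text \<open>
  Since \<open>g \<ge> c > 0\<close> and \<open>\<Sum> a\<^sub>i < \<infinity>\<close>, all vector measures that matter have finite total mass.
  A plate \<open>A\<^sub>l\<close> of infinite capacity carries measures \<open>\<tau>\<^sub>l\<close> of arbitrarily small energy with any
  prescribed value of \<open>\<integral> g d\<tau>\<^sub>l\<close> (restrict an almost minimizing unit measure to a compact set
  and rescale).  Adding \<open>\<tau>\<^sub>l\<close> with \<open>\<integral> g d\<tau>\<^sub>l = a\<^sub>l - \<integral> g d\<lambda>\<^sub>l\<close> to the relaxed solution \<open>\<lambda>\<close>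
  makes it admissible for the Gauss problem and, by Cauchy--Schwarz, hardly changes \<open>G\<^sub>\<chi>\<close>; hence the
  two infima agree.  A solution of the Gauss problem is therefore also a relaxed solution, and
  by strict convexity (compare with the midpoint) both have the same signed sum \<open>R\<close>, hence the
  same negative part, because positive and negative plates are disjoint.  Integrating \<open>g\<close> over
  it gives equality of the sums of the \<open>a\<^sub>i\<close> and of the \<open>\<integral> g d\<lambda>\<^sub>i\<close> over the negative plates,
  and \<open>\<integral> g d\<lambda>\<^sub>l \<le> a\<^sub>l\<close> turns this into termwise equality.
\<close>

section \<open>Sums of measures\<close>

lemma sets_sum_measure [simp, measurable_cong]:
  "sets (sum_measure \<mu> S) = sets borel"
  unfolding sum_measure_def using sets.sigma_sets_eq[of borel] by (subst sets_measure_of) auto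

lemma space_sum_measure [simp]: "space (sum_measure \<mu> S) = UNIV"
  using sets_eq_imp_space_eq[OF sets_sum_measure] by simp

text \<open>\<open>measure_of\<close> takes the values of its set function only if that function is
  countably additive. Here this amounts to interchanging two series of nonnegative terms, one of
  them read as an integral over counting measure.\<close>

lemma emeasure_sum_measure:
  assumes "\<And>i. i \<in> S \<Longrightarrow> sets (\<mu> i) = sets borel" and B: "B \<in> sets borel"
  shows "emeasure (sum_measure \<mu> S) B = (\<Sum>i. if i \<in> S then emeasure (\<mu> i) B else 0)"
  unfolding sum_measure_def
proof (rule emeasure_measure_of_sigma)
  show "sigma_algebra UNIV (sets (borel::'a measure))"
    using sets.sigma_algebra_axioms[of "borel::'a measure"] by simp
  show "positive (sets borel) (\<lambda>B. \<Sum>i. if i \<in> S then emeasure (\<mu> i) B else 0)"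
    by (simp add: positive_def cong: if_cong)
  show "countably_additive (sets borel) (\<lambda>B. \<Sum>i. if i \<in> S then emeasure (\<mu> i) B else 0)"
  proof (rule countably_additiveI)
    fix F :: "nat \<Rightarrow> 'a set"
    assume F: "range F \<subseteq> sets borel" "disjoint_family F"
    have "(\<Sum>n. \<Sum>i. if i \<in> S then emeasure (\<mu> i) (F n) else 0)
        = (\<Sum>i. \<Sum>n. if i \<in> S then emeasure (\<mu> i) (F n) else 0)"
      unfolding nn_integral_count_space_nat[symmetric, of "\<lambda>n. \<Sum>i. _ n i"]
      by (subst nn_integral_suminf) (auto simp: nn_integral_count_space_nat)
    also have "\<dots> = (\<Sum>i. if i \<in> S then emeasure (\<mu> i) (\<Union>n. F n) else 0)"
      using F assms(1) by (intro suminf_cong) (auto simp: suminf_emeasure)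
    finally show "(\<Sum>n. \<Sum>i. if i \<in> S then emeasure (\<mu> i) (F n) else 0)
        = (\<Sum>i. if i \<in> S then emeasure (\<mu> i) (\<Union>n. F n) else 0)" .
  qed
qed (use B in auto)

lemma nn_integral_sum_measure:
  assumes sets: "\<And>i. i \<in> S \<Longrightarrow> sets (\<mu> i) = sets borel"
    and f: "f \<in> borel_measurable borel"
  shows "(\<integral>\<^sup>+x. f x \<partial>sum_measure \<mu> S) = (\<Sum>i. if i \<in> S then \<integral>\<^sup>+x. f x \<partial>\<mu> i else 0)"
  using f
proof induction
  case (cong f g)
  then have "f = g" by auto
  then show ?case using cong.IH by (simp cong: if_cong)
next
  case (set B)
  then show ?case
    using sets by (simp add: emeasure_sum_measure cong: if_cong)
next
  case (mult u c)
  have m: "i \<in> S \<Longrightarrow> u \<in> borel_measurable (\<mu> i)" for i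
    using mult sets by (simp cong: measurable_cong_sets)
  have "u \<in> borel_measurable (sum_measure \<mu> S)"
    using mult by (simp cong: measurable_cong_sets)
  then have "(\<integral>\<^sup>+x. c * u x \<partial>sum_measure \<mu> S) = c * (\<Sum>i. if i \<in> S then \<integral>\<^sup>+x. u x \<partial>\<mu> i else 0)"
    using mult by (simp add: nn_integral_cmult)
  also have "\<dots> = (\<Sum>i. c * (if i \<in> S then \<integral>\<^sup>+x. u x \<partial>\<mu> i else 0))"
    by simp
  also have "\<dots> = (\<Sum>i. if i \<in> S then \<integral>\<^sup>+x. c * u x \<partial>\<mu> i else 0)"
    by (intro suminf_cong) (auto simp: nn_integral_cmult m)
  finally show ?case .
next
  case (add u v)
  have m: "i \<in> S \<Longrightarrow> u \<in> borel_measurable (\<mu> i)" "i \<in> S \<Longrightarrow> v \<in> borel_measurable (\<mu> i)" for i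
    using add sets by (simp_all cong: measurable_cong_sets)
  have "u \<in> borel_measurable (sum_measure \<mu> S)" "v \<in> borel_measurable (sum_measure \<mu> S)"
    using add by (simp_all cong: measurable_cong_sets)
  then have "(\<integral>\<^sup>+x. v x + u x \<partial>sum_measure \<mu> S)
      = (\<Sum>i. if i \<in> S then \<integral>\<^sup>+x. v x \<partial>\<mu> i else 0) + (\<Sum>i. if i \<in> S then \<integral>\<^sup>+x. u x \<partial>\<mu> i else 0)"
    using add by (simp add: nn_integral_add)
  also have "\<dots> = (\<Sum>i. (if i \<in> S then \<integral>\<^sup>+x. v x \<partial>\<mu> i else 0) + (if i \<in> S then \<integral>\<^sup>+x. u x \<partial>\<mu> i else 0))"
    by (intro suminf_add) auto
  also have "\<dots> = (\<Sum>i. if i \<in> S then \<integral>\<^sup>+x. v x + u x \<partial>\<mu> i else 0)"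
    by (intro suminf_cong) (auto simp: nn_integral_add m)
  finally show ?case .
next
  case (seq U)
  have m: "i \<in> S \<Longrightarrow> U n \<in> borel_measurable (\<mu> i)" for i n
    using seq sets by (simp cong: measurable_cong_sets)
  have "U n \<in> borel_measurable (sum_measure \<mu> S)" for n
    using seq by (simp cong: measurable_cong_sets)
  then have "(\<integral>\<^sup>+x. (SUP n. U n x) \<partial>sum_measure \<mu> S)
      = (SUP n. \<Sum>i. if i \<in> S then \<integral>\<^sup>+x. U n x \<partial>\<mu> i else 0)"
    using seq by (simp add: nn_integral_monotone_convergence_SUP)
  \<comment> \<open>Each term increases in \<open>n\<close>, so the supremum passes through the
    series.\<close>
  also have "\<dots> = (\<Sum>i. SUP n. if i \<in> S then \<integral>\<^sup>+x. U n x \<partial>\<mu> i else 0)"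
    using \<open>incseq U\<close>
    by (intro ennreal_suminf_SUP_eq[symmetric])
       (auto simp: incseq_def le_fun_def intro!: nn_integral_mono)
  also have "\<dots> = (\<Sum>i. if i \<in> S then \<integral>\<^sup>+x. (SUP n. U n x) \<partial>\<mu> i else 0)"
    using seq by (intro suminf_cong) (auto simp: nn_integral_monotone_convergence_SUP m)
  finally have "(\<integral>\<^sup>+x. (SUP n. U n x) \<partial>sum_measure \<mu> S)
      = (\<Sum>i. if i \<in> S then \<integral>\<^sup>+x. (SUP n. U n x) \<partial>\<mu> i else 0)" .
  moreover have "Sup (range U) = (\<lambda>x. SUP n. U n x)" by (auto simp: fun_eq_iff image_comp)
  ultimately show ?case by (simp only:)
qed

text \<open>Encoded as a series with two nonzero terms, so that addition inherits every lemma on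
  countable sums.\<close>

definition add_measure :: "'a::topological_space measure \<Rightarrow> 'a measure \<Rightarrow> 'a measure" where
  "add_measure \<mu> \<nu> = sum_measure (\<lambda>i. if i = 0 then \<mu> else \<nu>) {0, 1}"

lemma suminf_two:
  fixes u v :: ennreal
  shows "(\<Sum>i::nat. if i \<in> {0, 1} then if i = 0 then u else v else 0) = u + v"
  by (subst suminf_finite[of "{0, 1}"]) auto

lemma sets_add_measure [simp, measurable_cong]: "sets (add_measure \<mu> \<nu>) = sets borel"
  by (simp add: add_measure_def)

lemma emeasure_add_measure:
  assumes "sets \<mu> = sets borel" "sets \<nu> = sets borel" "B \<in> sets borel"
  shows "emeasure (add_measure \<mu> \<nu>) B = emeasure \<mu> B + emeasure \<nu> B"
proof -
  have "emeasure (add_measure \<mu> \<nu>) B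
      = (\<Sum>i::nat. if i \<in> {0, 1} then if i = 0 then emeasure \<mu> B else emeasure \<nu> B else 0)"
    unfolding add_measure_def using assms
    by (subst emeasure_sum_measure) (auto intro!: suminf_cong)
  then show ?thesis by (simp only: suminf_two)
qed

lemma nn_integral_add_measure:
  assumes "sets \<mu> = sets borel" "sets \<nu> = sets borel" "f \<in> borel_measurable borel"
  shows "(\<integral>\<^sup>+x. f x \<partial>add_measure \<mu> \<nu>) = (\<integral>\<^sup>+x. f x \<partial>\<mu>) + (\<integral>\<^sup>+x. f x \<partial>\<nu>)"
proof -
  have "(\<integral>\<^sup>+x. f x \<partial>add_measure \<mu> \<nu>)
      = (\<Sum>i::nat. if i \<in> {0, 1} then if i = 0 then \<integral>\<^sup>+x. f x \<partial>\<mu> else \<integral>\<^sup>+x. f x \<partial>\<nu> else 0)"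
    unfolding add_measure_def using assms
    by (subst nn_integral_sum_measure) (auto intro!: suminf_cong)
  then show ?thesis by (simp only: suminf_two)
qed

section \<open>Finite Radon measures\<close>

text \<open>For bounded Radon measures inner regularity by compact sets extends from open to all
  Borel sets, and this property in turn characterizes them; see \<open>finite_radon_inner\<close>
  and \<open>finite_radonI\<close>.\<close>

definition finite_radon :: "'a::topological_space measure \<Rightarrow> bool" where
  "finite_radon \<mu> \<longleftrightarrow> radon \<mu> \<and> emeasure \<mu> UNIV < \<infinity>"

lemma finite_radon_sets: "finite_radon \<mu> \<Longrightarrow> sets \<mu> = sets borel"
  by (simp add: finite_radon_def radon_def)

lemma finite_radon_space: "finite_radon \<mu> \<Longrightarrow> space \<mu> = UNIV"
  using sets_eq_imp_space_eq[OF finite_radon_sets] by simp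

lemma finite_radon_finite: "finite_radon \<mu> \<Longrightarrow> emeasure \<mu> B < \<infinity>"
  using emeasure_space[of \<mu> B]
  by (auto simp: finite_radon_space finite_radon_def intro: le_less_trans)

lemma finite_radon_finite_measure: "finite_radon \<mu> \<Longrightarrow> finite_measure \<mu>"
  by (rule finite_measureI) (metis finite_radon_finite less_irrefl infinity_ennreal_def)

text \<open>Choose a compact \<open>K\<close> carrying all but \<open>d\<close> of the mass and an
  open \<open>U\<close> that exceeds the complement of \<open>B\<close> by less than
  \<open>d\<close>. Then \<open>K - U\<close> is a compact subset of \<open>B\<close> and misses
  less than \<open>d + d\<close> of it.\<close>

lemma finite_radon_inner:
  fixes \<mu> :: "'a::t2_space measure"
  assumes \<mu>: "finite_radon \<mu>" and B: "B \<in> sets borel" and e: "(0::ennreal) < e"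
  shows "\<exists>K. compact K \<and> K \<subseteq> B \<and> emeasure \<mu> (B - K) < e"
proof -
  have [simp]: "sets \<mu> = sets borel" using \<mu> by (rule finite_radon_sets)
  have fin: "emeasure \<mu> C < top" "emeasure \<mu> C \<noteq> top" for C
    using finite_radon_finite[OF \<mu>, of C] by (auto simp: less_top)
  \<comment> \<open>Half of \<open>e\<close>, or 1 if \<open>e\<close> is infinite; a finite
    \<open>d\<close> can be cancelled in \<open>ennreal\<close>.\<close>
  obtain d :: ennreal where d: "0 < d" "d + d \<le> e" "d \<noteq> top"
  proof (cases e)
    case (real r)
    show ?thesis
      using real e by (intro that[of "ennreal (r/2)"]) (auto simp: ennreal_plus[symmetric] simp del: ennreal_plus)
  next
    case top
    then show ?thesis by (intro that[of 1]) auto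
  qed
  have outer: "\<exists>U. open U \<and> C \<subseteq> U \<and> emeasure \<mu> (U - C) < d" if C: "C \<in> sets borel" for C
  proof -
    have "emeasure \<mu> C < emeasure \<mu> C + d"
      using d fin[of C] by (metis ennreal_add_left_cancel_less add.right_neutral infinity_ennreal_def)
    moreover have "emeasure \<mu> C = (INF U\<in>{U. open U \<and> C \<subseteq> U}. emeasure \<mu> U)"
      using \<mu> C by (auto simp: finite_radon_def radon_def)
    ultimately obtain U where U: "open U" "C \<subseteq> U" "emeasure \<mu> U < emeasure \<mu> C + d"
      by (auto simp: INF_less_iff)
    moreover have "emeasure \<mu> (U - C) < d"
    proof -
      have "emeasure \<mu> C + emeasure \<mu> (U - C) = emeasure \<mu> U"
        using U C by (subst plus_emeasure) (auto intro!: arg_cong[where f="emeasure \<mu>"])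
      then show ?thesis using U(3) fin[of C]
        by (metis ennreal_add_left_cancel_less infinity_ennreal_def)
    qed
    ultimately show ?thesis by blast
  qed
  have "\<exists>K. compact K \<and> emeasure \<mu> (UNIV - K) < d"
  \<comment> \<open>Zero mass is treated apart, since then no compact set strictly exceeds the
    truncated difference used below.\<close>
  proof (cases "emeasure \<mu> UNIV = 0")
    case True
    then show ?thesis using d by (intro exI[of _ "{}"]) auto
  next
    case False
    have "emeasure \<mu> UNIV - d < emeasure \<mu> UNIV"
      using False d fin by (intro ennreal_between) (auto simp: zero_less_iff_neq_zero)
    moreover have "emeasure \<mu> UNIV = (SUP K\<in>{K. compact K \<and> K \<subseteq> UNIV}. emeasure \<mu> K)"
      using \<mu> by (auto simp: finite_radon_def radon_def)
    ultimately obtain K where K: "compact K" "emeasure \<mu> UNIV - d < emeasure \<mu> K"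
      by (auto simp: less_SUP_iff)
    have "emeasure \<mu> K + emeasure \<mu> (UNIV - K) = emeasure \<mu> UNIV"
      using K by (subst plus_emeasure) (auto intro!: arg_cong[where f="emeasure \<mu>"] intro: borel_compact)
    moreover have "emeasure \<mu> UNIV < emeasure \<mu> K + d"
    proof (rule ccontr)
      assume "\<not> emeasure \<mu> UNIV < emeasure \<mu> K + d"
      then have "emeasure \<mu> K + d - d \<le> emeasure \<mu> UNIV - d"
        by (intro ennreal_minus_mono) auto
      then show False using K d by (simp add: ennreal_add_diff_cancel_right leD)
    qed
    ultimately have "emeasure \<mu> (UNIV - K) < d"
      by (metis ennreal_add_left_cancel_less)
    then show ?thesis using K by blast
  qed
  then obtain K where K: "compact K" "emeasure \<mu> (UNIV - K) < d" by blast
  obtain U where U: "open U" "- B \<subseteq> U" "emeasure \<mu> (U - - B) < d"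
    using outer[of "- B"] B by auto
  have Kb: "K \<in> sets borel" "U \<in> sets borel" using K U by (auto intro: borel_compact)
  have "emeasure \<mu> (B - (K - U)) \<le> emeasure \<mu> ((UNIV - K) \<union> (U - - B))"
    using Kb B by (intro emeasure_mono) auto
  also have "\<dots> \<le> emeasure \<mu> (UNIV - K) + emeasure \<mu> (U - - B)"
    using Kb B by (intro emeasure_subadditive) auto
  also have "\<dots> < d + d" using K U by (intro add_strict_mono) auto
  finally show ?thesis
    using K U d by (intro exI[of _ "K - U"]) (auto intro: compact_diff)
qed

text \<open>Outer regularity at \<open>B\<close> follows by passing to complements: a compact subset
  of \<open>- B\<close> is closed in a Hausdorff space, so its complement is an open set containing
  \<open>B\<close> with small excess.\<close>

lemma finite_radonI:
  fixes \<mu> :: "'a::t2_space measure"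
  assumes sets[simp]: "sets \<mu> = sets borel" and fin: "emeasure \<mu> UNIV < \<infinity>"
    and inner: "\<And>B e. B \<in> sets borel \<Longrightarrow> (0::ennreal) < e \<Longrightarrow>
      \<exists>K. compact K \<and> K \<subseteq> B \<and> emeasure \<mu> (B - K) < e"
  shows "finite_radon \<mu>"
proof -
  have le: "emeasure \<mu> C \<le> emeasure \<mu> UNIV" for C
    using emeasure_space[of \<mu> C] sets_eq_imp_space_eq[OF sets] by simp
  have 1: "emeasure \<mu> U = (SUP K\<in>{K. compact K \<and> K \<subseteq> U}. emeasure \<mu> K)" if "open U" for U
  proof (rule antisym)
    have Ub: "U \<in> sets borel" using that by (rule borel_open)
    show "emeasure \<mu> U \<le> (SUP K\<in>{K. compact K \<and> K \<subseteq> U}. emeasure \<mu> K)"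
    proof (rule ennreal_le_epsilon)
      fix e :: real assume "0 < e"
      then obtain K where K: "compact K" "K \<subseteq> U" "emeasure \<mu> (U - K) < ennreal e"
        using inner[of U "ennreal e"] Ub by auto
      have "emeasure \<mu> U = emeasure \<mu> K + emeasure \<mu> (U - K)"
        using K that by (subst plus_emeasure) (auto intro!: arg_cong[where f="emeasure \<mu>"] intro: borel_compact)
      also have "\<dots> \<le> (SUP K\<in>{K. compact K \<and> K \<subseteq> U}. emeasure \<mu> K) + ennreal e"
        using K by (intro add_mono) (auto intro!: SUP_upper)
      finally show "emeasure \<mu> U \<le> (SUP K\<in>{K. compact K \<and> K \<subseteq> U}. emeasure \<mu> K) + ennreal e" .
    qed
    show "(SUP K\<in>{K. compact K \<and> K \<subseteq> U}. emeasure \<mu> K) \<le> emeasure \<mu> U"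
      using that by (intro SUP_least emeasure_mono) auto
  qed
  have 2: "emeasure \<mu> B = (INF U\<in>{U. open U \<and> B \<subseteq> U}. emeasure \<mu> U)" if B: "B \<in> sets borel" for B
  proof (rule antisym)
    show "(INF U\<in>{U. open U \<and> B \<subseteq> U}. emeasure \<mu> U) \<le> emeasure \<mu> B"
    proof (rule ennreal_le_epsilon)
      fix e :: real assume "0 < e"
      then obtain K where K: "compact K" "K \<subseteq> - B" "emeasure \<mu> (- B - K) < ennreal e"
        using inner[of "- B" "ennreal e"] B by auto
      have "(INF U\<in>{U. open U \<and> B \<subseteq> U}. emeasure \<mu> U) \<le> emeasure \<mu> (- K)"
        using K by (intro INF_lower) (auto intro: compact_imp_closed)
      also have "- K = B \<union> (- B - K)" using K by auto
      also have "emeasure \<mu> \<dots> \<le> emeasure \<mu> B + emeasure \<mu> (- B - K)"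
        using B K by (intro emeasure_subadditive) (auto intro: borel_compact)
      also have "\<dots> \<le> emeasure \<mu> B + ennreal e"
        using K by (intro add_mono) auto
      finally show "(INF U\<in>{U. open U \<and> B \<subseteq> U}. emeasure \<mu> U) \<le> emeasure \<mu> B + ennreal e" .
    qed
    show "emeasure \<mu> B \<le> (INF U\<in>{U. open U \<and> B \<subseteq> U}. emeasure \<mu> U)"
      using that by (intro INF_greatest emeasure_mono) auto
  qed
  show ?thesis
    unfolding finite_radon_def radon_def using fin le 1 2 by (auto intro: le_less_trans)
qed

text \<open>A compact set that is nearly optimal for \<mu>, at a tolerance divided by the constant,
  is nearly optimal for \<nu>.\<close>

lemma finite_radon_dominated:
  fixes \<mu> :: "'a::t2_space measure"
  assumes \<mu>: "finite_radon \<mu>" and sets: "sets \<nu> = sets borel"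
    and le: "\<And>B. B \<in> sets borel \<Longrightarrow> emeasure \<nu> B \<le> ennreal c * emeasure \<mu> B"
  shows "finite_radon \<nu>"
proof (rule finite_radonI[OF sets])
  have "ennreal c * emeasure \<mu> UNIV < \<infinity>"
    using finite_radon_finite[OF \<mu>, of UNIV] by (auto simp: ennreal_mult_less_top)
  then show "emeasure \<nu> UNIV < \<infinity>"
    using le[of UNIV] by (auto intro: le_less_trans)
  fix B :: "'a set" and e :: ennreal assume B: "B \<in> sets borel" and e: "0 < e"
  \<comment> \<open>Enlarging the constant to at least 1 makes the division by it
    legitimate.\<close>
  let ?c = "max c 1"
  have "0 < e / ennreal ?c" using e by (auto simp: ennreal_zero_less_divide)
  then obtain K where K: "compact K" "K \<subseteq> B" "emeasure \<mu> (B - K) < e / ennreal ?c"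
    using finite_radon_inner[OF \<mu> B] by blast
  have "emeasure \<nu> (B - K) \<le> ennreal ?c * emeasure \<mu> (B - K)"
    using K B by (intro order_trans[OF le] mult_right_mono) (auto intro: borel_compact ennreal_leI)
  also have "\<dots> < ennreal ?c * (e / ennreal ?c)"
    using K by (intro ennreal_mult_strict_left_mono) auto
  also have "\<dots> = e"
    by (simp add: ennreal_times_divide mult.commute[of _ e] mult_divide_eq_ennreal)
  finally show "\<exists>K. compact K \<and> K \<subseteq> B \<and> emeasure \<nu> (B - K) < e"
    using K by blast
qed

text \<open>Choose a compact \<open>K i\<close> for each summand with a loss below the
  \<open>i\<close>-th term of a geometric series with sum \<open>d\<close>. The union of all
  \<open>K i\<close> then loses at most \<open>d\<close>, and since the total mass is finite,
  continuity from above shows that finitely many \<open>K i\<close> suffice.\<close>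

lemma finite_radon_sum_measure:
  fixes \<mu> :: "nat \<Rightarrow> 'a::t2_space measure"
  assumes \<mu>: "\<And>i. i \<in> S \<Longrightarrow> finite_radon (\<mu> i)"
    and fin: "(\<Sum>i. if i \<in> S then emeasure (\<mu> i) UNIV else 0) < \<infinity>"
  shows "finite_radon (sum_measure \<mu> S)"
proof (rule finite_radonI)
  let ?M = "sum_measure \<mu> S"
  have em: "emeasure ?M B = (\<Sum>i. if i \<in> S then emeasure (\<mu> i) B else 0)" if "B \<in> sets borel" for B
    using that \<mu> by (intro emeasure_sum_measure) (auto dest: finite_radon_sets)
  show fin': "emeasure ?M UNIV < \<infinity>" using fin by (simp add: em)
  fix B :: "'a set" and e :: ennreal assume B: "B \<in> sets borel" and e: "0 < e"
  obtain d :: real where d: "0 < d" "ennreal d < e"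
  proof (cases e)
    case (real r)
    then show ?thesis using e by (intro that[of "r / 2"]) (auto simp: ennreal_less_iff)
  next
    case top
    then show ?thesis by (intro that[of 1]) auto
  qed
  let ?d = "\<lambda>i::nat. ennreal (d * (1/2) ^ Suc i)"
  have "\<exists>K. compact K \<and> K \<subseteq> B \<and> (i \<in> S \<longrightarrow> emeasure (\<mu> i) (B - K) < ?d i)" for i
    using finite_radon_inner[OF \<mu> B, of i "?d i"] d by (cases "i \<in> S") auto
  then obtain K where K: "\<And>i. compact (K i)" "\<And>i. K i \<subseteq> B"
    "\<And>i. i \<in> S \<Longrightarrow> emeasure (\<mu> i) (B - K i) < ?d i" by metis
  have Kb: "K i \<in> sets borel" for i using K by (auto intro: borel_compact)
  define C where "C n = B - (\<Union>i\<le>n. K i)" for n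
  have Cb: "C n \<in> sets borel" for n using B Kb by (auto simp: C_def)
  have "emeasure ?M (\<Inter>n. C n) = (\<Sum>i. if i \<in> S then emeasure (\<mu> i) (\<Inter>n. C n) else 0)"
    using Cb by (intro em) auto
  also have "\<dots> \<le> (\<Sum>i. ?d i)"
  proof (intro suminf_le)
    fix i
    have "emeasure (\<mu> i) (\<Inter>n. C n) \<le> emeasure (\<mu> i) (B - K i)" if "i \<in> S"
      using that B Kb finite_radon_sets[OF \<mu>] by (intro emeasure_mono) (auto simp: C_def)
    then show "(if i \<in> S then emeasure (\<mu> i) (\<Inter>n. C n) else 0) \<le> ?d i"
      using K(3)[of i] by (auto intro: order_trans less_imp_le)
  qed auto
  also have "(\<lambda>i. d * (1/2) ^ Suc i) sums (d * 1)"
    by (intro sums_mult power_half_series)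
  then have "(\<Sum>i. ?d i) = ennreal d"
    using d by (intro suminf_ennreal_eq) auto
  finally have lim: "emeasure ?M (\<Inter>n. C n) < e" using d by auto
  have "(\<lambda>n. emeasure ?M (C n)) \<longlonglongrightarrow> emeasure ?M (\<Inter>n. C n)"
  proof (rule Lim_emeasure_decseq)
    show "range C \<subseteq> sets ?M" using Cb by auto
    show "decseq C" by (force simp: decseq_def C_def)
    have "emeasure ?M (C i) \<le> emeasure ?M UNIV" for i by (intro emeasure_mono) auto
    then show "emeasure ?M (C i) \<noteq> \<infinity>" for i using fin' by (metis leD)
  qed
  then have "eventually (\<lambda>n. emeasure ?M (C n) < e) sequentially"
    using lim by (rule order_tendstoD)
  then obtain n where "emeasure ?M (C n) < e" by (auto simp: eventually_sequentially)
  then show "\<exists>K. compact K \<and> K \<subseteq> B \<and> emeasure ?M (B - K) < e"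
    using K by (intro exI[of _ "\<Union>i\<le>n. K i"]) (auto simp: C_def intro!: compact_UN)
qed simp

lemma finite_radon_add_measure:
  fixes \<mu> \<nu> :: "'a::t2_space measure"
  assumes "finite_radon \<mu>" "finite_radon \<nu>"
  shows "finite_radon (add_measure \<mu> \<nu>)"
  unfolding add_measure_def
proof (rule finite_radon_sum_measure)
  have "(\<Sum>i::nat. if i \<in> {0, 1} then emeasure (if i = 0 then \<mu> else \<nu>) UNIV else 0)
     = (\<Sum>i::nat. if i \<in> {0, 1} then if i = 0 then emeasure \<mu> UNIV else emeasure \<nu> UNIV else 0)"
    by (intro suminf_cong) auto
  also have "\<dots> < \<infinity>"
    using assms finite_radon_finite by (simp only: suminf_two) auto
  finally show "(\<Sum>i::nat. if i \<in> {0, 1} then emeasure (if i = 0 then \<mu> else \<nu>) UNIV else 0) < \<infinity>" .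
qed (use assms in auto)

lemma finite_radon_scale_measure:
  fixes \<mu> :: "'a::t2_space measure"
  assumes "finite_radon \<mu>"
  shows "finite_radon (scale_measure (ennreal c) \<mu>)"
  using finite_radon_sets[OF assms] by (intro finite_radon_dominated[OF assms, of _ c]) auto

lemma finite_radon_density_indicator:
  fixes \<mu> :: "'a::t2_space measure"
  assumes \<mu>: "finite_radon \<mu>" and B: "B \<in> sets borel"
  shows "finite_radon (density \<mu> (indicator B))"
    and "C \<in> sets borel \<Longrightarrow> emeasure (density \<mu> (indicator B)) C = emeasure \<mu> (B \<inter> C)"
proof -
  show em: "C \<in> sets borel \<Longrightarrow> emeasure (density \<mu> (indicator B)) C = emeasure \<mu> (B \<inter> C)" for C
    using B finite_radon_sets[OF \<mu>] by (simp add: emeasure_restricted)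
  show "finite_radon (density \<mu> (indicator B))"
  proof (rule finite_radon_dominated[OF \<mu>, of _ 1])
    fix C :: "'a set" assume C: "C \<in> sets borel"
    then show "emeasure (density \<mu> (indicator B)) C \<le> ennreal 1 * emeasure \<mu> C"
      using finite_radon_sets[OF \<mu>] by (auto simp: em intro!: emeasure_mono)
  qed (use finite_radon_sets[OF \<mu>] in auto)
qed

text \<open>A Hahn set \<open>Y\<close> of \<open>P - N\<close> does it: \<sigma> is
  \<open>P - N\<close> on \<open>Y\<close>, \<tau> is \<open>N - P\<close> off \<open>Y\<close>. The
  pair is singular, so positive definiteness can be applied to it, and \<open>P\<close> and
  \<open>N\<close> differ from it by the same measure \<open>m\<close>.\<close>

lemma finite_radon_jordan:
  fixes P N :: "'a::t2_space measure"
  assumes P: "finite_radon P" and N: "finite_radon N"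
  obtains \<sigma> \<tau> m where "finite_radon \<sigma>" "finite_radon \<tau>" "finite_radon m"
    "P = add_measure \<sigma> m" "N = add_measure \<tau> m" "signed_radon (\<sigma>, \<tau>)"
proof -
  note [simp] = finite_radon_sets[OF P] finite_radon_sets[OF N]
  obtain Y where Y: "Y \<in> sets borel"
    "\<And>X. X \<in> sets borel \<Longrightarrow> X \<subseteq> Y \<Longrightarrow> emeasure N X \<le> emeasure P X"
    "\<And>X. X \<in> sets borel \<Longrightarrow> X \<inter> Y = {} \<Longrightarrow> emeasure P X \<le> emeasure N X"
    using finite_unsigned_Hahn_decomposition[OF finite_radon_finite_measure[OF P]
        finite_radon_finite_measure[OF N]] by auto
  have Y': "- Y \<in> sets borel" using Y by auto
  let ?r = "\<lambda>\<mu> B. density \<mu> (indicator B) :: 'a measure"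
  define \<sigma> where "\<sigma> = diff_measure (?r P Y) (?r N Y)"
  define \<tau> where "\<tau> = diff_measure (?r N (- Y)) (?r P (- Y))"
  \<comment> \<open>the lattice infimum of \<open>P\<close> and \<open>N\<close>\<close>
  define m where "m = add_measure (?r N Y) (?r P (- Y))"
  note rP = finite_radon_density_indicator[OF P] and rN = finite_radon_density_indicator[OF N]
  have sets[simp]: "sets \<sigma> = sets borel" "sets \<tau> = sets borel"
    by (simp_all add: \<sigma>_def \<tau>_def)
  have \<sigma>: "emeasure \<sigma> B = emeasure P (Y \<inter> B) - emeasure N (Y \<inter> B)" if "B \<in> sets borel" for B
    unfolding \<sigma>_def using that Y
    by (subst emeasure_diff_measure)
       (auto simp: rP(2) rN(2) intro!: finite_radon_finite_measure rP(1) rN(1))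
  have \<tau>: "emeasure \<tau> B = emeasure N (- Y \<inter> B) - emeasure P (- Y \<inter> B)" if "B \<in> sets borel" for B
    unfolding \<tau>_def using that Y Y'
    by (subst emeasure_diff_measure)
       (auto simp: rP(2) rN(2) intro!: finite_radon_finite_measure rP(1) rN(1))
  have m: "emeasure m B = emeasure N (Y \<inter> B) + emeasure P (- Y \<inter> B)" if "B \<in> sets borel" for B
    unfolding m_def using that Y Y' by (subst emeasure_add_measure) (auto simp: rP(2) rN(2))
  have frm: "finite_radon m"
    unfolding m_def using Y Y' by (intro finite_radon_add_measure rP(1) rN(1))
  have fr\<sigma>: "finite_radon \<sigma>"
  proof (rule finite_radon_dominated[OF P, of _ 1])
    fix B :: "'a set" assume B: "B \<in> sets borel"
    have "emeasure \<sigma> B \<le> emeasure P (Y \<inter> B)" using \<sigma>[OF B] by (simp add: diff_le_self_ennreal)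
    also have "\<dots> \<le> emeasure P B" using B by (intro emeasure_mono) auto
    finally show "emeasure \<sigma> B \<le> ennreal 1 * emeasure P B" by simp
  qed simp
  have fr\<tau>: "finite_radon \<tau>"
  proof (rule finite_radon_dominated[OF N, of _ 1])
    fix B :: "'a set" assume B: "B \<in> sets borel"
    have "emeasure \<tau> B \<le> emeasure N (- Y \<inter> B)" using \<tau>[OF B] by (simp add: diff_le_self_ennreal)
    also have "\<dots> \<le> emeasure N B" using B by (intro emeasure_mono) auto
    finally show "emeasure \<tau> B \<le> ennreal 1 * emeasure N B" by simp
  qed simp
  have msets[simp]: "sets m = sets borel" by (simp add: m_def)
  have split: "emeasure M B = emeasure M (Y \<inter> B) + emeasure M (- Y \<inter> B)"
    if "sets M = sets borel" "B \<in> sets borel" for M B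
    using that Y by (subst plus_emeasure) (auto intro!: arg_cong[where f="emeasure M"])
  have "P = add_measure \<sigma> m"
  proof (rule measure_eqI)
    fix B assume "B \<in> sets P"
    then have B: "B \<in> sets borel" by simp
    have "emeasure (add_measure \<sigma> m) B
        = (emeasure P (Y \<inter> B) - emeasure N (Y \<inter> B) + emeasure N (Y \<inter> B)) + emeasure P (- Y \<inter> B)"
      using B by (simp add: emeasure_add_measure \<sigma> m ac_simps)
    \<comment> \<open>Subtraction in \<open>ennreal\<close> is truncated, so adding \<open>N\<close>
      back restores \<open>P\<close> only because \<open>N\<close> is at most \<open>P\<close> on
      subsets of \<open>Y\<close>.\<close>
    also have "emeasure P (Y \<inter> B) - emeasure N (Y \<inter> B) + emeasure N (Y \<inter> B) = emeasure P (Y \<inter> B)"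
      using Y B by (intro diff_add_cancel_ennreal) auto
    finally show "emeasure P B = emeasure (add_measure \<sigma> m) B" using split[of P B] B by simp
  qed simp
  moreover have "N = add_measure \<tau> m"
  proof (rule measure_eqI)
    fix B assume "B \<in> sets N"
    then have B: "B \<in> sets borel" by simp
    have "emeasure (add_measure \<tau> m) B
        = emeasure N (Y \<inter> B) + (emeasure N (- Y \<inter> B) - emeasure P (- Y \<inter> B) + emeasure P (- Y \<inter> B))"
      using B by (simp add: emeasure_add_measure \<tau> m ac_simps)
    also have "emeasure N (- Y \<inter> B) - emeasure P (- Y \<inter> B) + emeasure P (- Y \<inter> B) = emeasure N (- Y \<inter> B)"
      using Y B by (intro diff_add_cancel_ennreal) auto
    finally show "emeasure N B = emeasure (add_measure \<tau> m) B" using split[of N B] B by simp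
  qed simp
  moreover have "signed_radon (\<sigma>, \<tau>)"
    unfolding signed_radon_def
    using fr\<sigma> fr\<tau> Y \<sigma>[of "UNIV - Y"] \<tau>[of Y] by (auto simp: finite_radon_def intro!: bexI[of _ Y])
  ultimately show ?thesis using that fr\<sigma> fr\<tau> frm by blast
qed

section \<open>Potentials and mutual energies\<close>

text \<open>Preparation for the semicontinuity of potentials. Take a simple function below
  \<open>f\<close> with integral above \<open>t\<close>, multiply its values by \<theta> < 1 and
  shrink its level sets to compact sets that keep the fraction \<theta> of their measure. This costs
  a factor of \<theta> squared and makes the inequality with \<open>f\<close> strict on compact
  sets.\<close>

lemma finite_radon_integral_inner_approx:
  fixes \<nu> :: "'a::t2_space measure"
  assumes \<nu>: "finite_radon \<nu>" and t: "t < (\<integral>\<^sup>+y. f y \<partial>\<nu>)"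
  shows "\<exists>(V::ennreal set) K c. finite V \<and> disjoint_family_on K V \<and>
    (\<forall>v\<in>V. compact (K v) \<and> (\<forall>y\<in>K v. c v < f y)) \<and> t < (\<Sum>v\<in>V. c v * emeasure \<nu> (K v))"
proof -
  note [simp] = finite_radon_sets[OF \<nu>] finite_radon_space[OF \<nu>]
  obtain s where s: "simple_function \<nu> s" "s \<le> f" "\<And>x. s x < top" "t < integral\<^sup>S \<nu> s"
    using t unfolding nn_integral_def_finite less_SUP_iff by auto
  define B where "B v = s -` {v}" for v
  \<comment> \<open>The value 0 is removed so that multiplying by \<theta> strictly decreases every
    remaining value.\<close>
  define V where "V = range s - {0}"
  define T where "T = (\<Sum>v\<in>V. v * emeasure \<nu> (B v))"
  have fin: "finite (range s)" using simple_functionD(1)[OF s(1)] by simp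
  have B: "B v \<in> sets borel" for v
    using simple_functionD(2)[OF s(1), of "{v}"] by (simp add: B_def)
  have "integral\<^sup>S \<nu> s = T"
    unfolding simple_integral_def T_def V_def using fin
    by (intro sum.mono_neutral_cong_right) (auto simp: B_def)
  with s have tT: "t < T" by simp
  have vfin: "v < top" "v \<noteq> top" if "v \<in> V" for v using that s(3) by (auto simp: V_def less_top)
  have "T < top"
    unfolding T_def using fin finite_radon_finite[OF \<nu>] vfin
    by (auto simp: ennreal_mult_less_top V_def)
  then obtain T' where T': "T = ennreal T'" "0 \<le> T'" by (cases T) auto
  obtain t' where t': "t = ennreal t'" "0 \<le> t'" using tT T' by (cases t) auto
  have lt: "t' < T'" using tT T' t' by (simp add: ennreal_less_iff)
  \<comment> \<open>With \<open>q\<close> the ratio of \<open>t\<close> to the integral, the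
    midpoint \<theta> of \<open>q\<close> and 1 satisfies \<theta> * \<theta> > 2 * \<theta> - 1 =
    \<open>q\<close>, because the square of 1 - \<theta> is positive.\<close>
  define q where "q = t' / T'"
  define \<theta> where "\<theta> = (1 + q) / 2"
  have q: "0 \<le> q" "q < 1" using lt t' by (auto simp: q_def)
  have \<theta>: "0 < \<theta>" "\<theta> < 1" using q by (auto simp: \<theta>_def)
  have "0 < (1 - \<theta>)\<^sup>2" using \<theta> by simp
  then have "2 * \<theta> - 1 < \<theta> * \<theta>" by (simp add: power2_eq_square algebra_simps)
  moreover have "q = 2 * \<theta> - 1" unfolding \<theta>_def by (simp add: field_simps)
  ultimately have "t' / T' < \<theta> * \<theta>" by (simp add: q_def)
  then have "t' < \<theta> * \<theta> * T'" using lt t' by (simp add: field_simps)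
  then have \<theta>T: "t < ennreal \<theta> * ennreal \<theta> * T"
    using T' t' \<theta> by (simp add: ennreal_mult[symmetric] ennreal_less_iff)
  have "\<exists>K. compact K \<and> K \<subseteq> B v \<and> ennreal \<theta> * emeasure \<nu> (B v) \<le> emeasure \<nu> K" for v
  proof (cases "emeasure \<nu> (B v) = 0")
    case True
    then show ?thesis by (intro exI[of _ "{}"]) auto
  next
    case False
    obtain b where b: "emeasure \<nu> (B v) = ennreal b" "0 < b"
      using finite_radon_finite[OF \<nu>, of "B v"] False by (cases "emeasure \<nu> (B v)") auto
    have "0 < ennreal ((1 - \<theta>) * b)" using \<theta> b by auto
    then obtain K where K: "compact K" "K \<subseteq> B v" "emeasure \<nu> (B v - K) < ennreal ((1 - \<theta>) * b)"
      using finite_radon_inner[OF \<nu> B] by blast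
    obtain k where k: "emeasure \<nu> K = ennreal k" "0 \<le> k"
      using finite_radon_finite[OF \<nu>, of K] by (cases "emeasure \<nu> K") auto
    have "ennreal b = emeasure \<nu> K + emeasure \<nu> (B v - K)"
      unfolding b(1)[symmetric] using K B[of v]
      by (subst plus_emeasure) (auto intro!: arg_cong[where f="emeasure \<nu>"] intro: borel_compact)
    also have "\<dots> \<le> ennreal k + ennreal ((1 - \<theta>) * b)"
      using K k by (intro add_mono) auto
    also have "\<dots> = ennreal (k + (1 - \<theta>) * b)" using \<theta> b k by (simp add: ennreal_plus)
    finally have "b \<le> k + (1 - \<theta>) * b" using k \<theta> b by (subst (asm) ennreal_le_iff) auto
    then have "\<theta> * b \<le> k" by (simp add: algebra_simps)
    then have "ennreal \<theta> * emeasure \<nu> (B v) \<le> emeasure \<nu> K"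
      using b k \<theta> by (simp add: ennreal_mult[symmetric] ennreal_leI)
    then show ?thesis using K by blast
  qed
  then obtain K where K: "\<And>v. compact (K v)" "\<And>v. K v \<subseteq> B v"
    "\<And>v. ennreal \<theta> * emeasure \<nu> (B v) \<le> emeasure \<nu> (K v)" by metis
  have "ennreal \<theta> * ennreal \<theta> * T = (\<Sum>v\<in>V. (ennreal \<theta> * v) * (ennreal \<theta> * emeasure \<nu> (B v)))"
    by (simp add: T_def sum_distrib_left ac_simps)
  also have "\<dots> \<le> (\<Sum>v\<in>V. (ennreal \<theta> * v) * emeasure \<nu> (K v))"
    using K by (intro sum_mono mult_left_mono) auto
  finally have "t < (\<Sum>v\<in>V. (ennreal \<theta> * v) * emeasure \<nu> (K v))" using \<theta>T by simp
  moreover have "disjoint_family_on K V"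
    using K(2) unfolding disjoint_family_on_def B_def by blast
  moreover have "ennreal \<theta> * v < f y" if v: "v \<in> V" and y: "y \<in> K v" for v y
  proof -
    obtain w where w: "v = ennreal w" "0 < w" using vfin[OF v] v by (cases v) (auto simp: V_def)
    have "ennreal \<theta> * v < v" using w \<theta> by (simp add: ennreal_mult[symmetric] ennreal_less_iff)
    also have "v = s y" using K(2) y by (auto simp: B_def)
    also have "\<dots> \<le> f y" using s(2) by (simp add: le_fun_def)
    finally show ?thesis .
  qed
  ultimately show ?thesis using fin K(1)
    by (intro exI[of _ V] exI[of _ K] exI[of _ "\<lambda>v. ennreal \<theta> * v"]) (auto simp: V_def)
qed

section \<open>Lower semicontinuous kernels: potentials and bilinearity of the mutual energy\<close>

locale lsc_kernel =
  fixes \<kappa> :: "'a::t2_space \<Rightarrow> 'a \<Rightarrow> ennreal"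
  assumes lsc: "kernel_lsc \<kappa>"
begin

lemma kernel_measurable: "\<kappa> x \<in> borel_measurable borel"
proof (rule borel_measurableI_greater)
  fix t
  have "open (Pair x -` {z. t < \<kappa> (fst z) (snd z)})"
    using lsc unfolding kernel_lsc_def by (intro open_vimage continuous_intros) auto
  then show "{y \<in> space borel. t < \<kappa> x y} \<in> sets borel" by (simp add: vimage_def borel_open)
qed

text \<open>At \<open>x0\<close> the integral is approximated from below by finitely many compact
  pieces on which \<kappa> strictly exceeds constants. By the tube lemma each strict inequality
  persists for \<open>x\<close> near \<open>x0\<close>, uniformly over the compact piece.\<close>

lemma pot_lsc:
  assumes \<nu>: "finite_radon \<nu>"
  shows "open {x. t < pot \<kappa> \<nu> x}"
proof (subst open_subopen, safe)
  fix x0 assume "t < pot \<kappa> \<nu> x0"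
  then obtain V :: "ennreal set" and K c where V': "finite V \<and> disjoint_family_on K V \<and>
    (\<forall>v\<in>V. compact (K v) \<and> (\<forall>y\<in>K v. c v < \<kappa> x0 y)) \<and> t < (\<Sum>v\<in>V. c v * emeasure \<nu> (K v))"
    using finite_radon_integral_inner_approx[OF \<nu>, of t "\<kappa> x0"] unfolding pot_def by blast
  then have V: "finite V" "disjoint_family_on K V" "\<And>v. v \<in> V \<Longrightarrow> compact (K v)"
    "\<And>v y. v \<in> V \<Longrightarrow> y \<in> K v \<Longrightarrow> c v < \<kappa> x0 y" "t < (\<Sum>v\<in>V. c v * emeasure \<nu> (K v))"
    by auto
  have "\<exists>X. x0 \<in> X \<and> open X \<and> X \<times> K v \<subseteq> {z. c v < \<kappa> (fst z) (snd z)}" if v: "v \<in> V" for v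
    using V v lsc by (intro Elementary_Topology.tube_lemma) (auto simp: kernel_lsc_def)
  then obtain X where X: "\<And>v. v \<in> V \<Longrightarrow> x0 \<in> X v \<and> open (X v) \<and> X v \<times> K v \<subseteq> {z. c v < \<kappa> (fst z) (snd z)}"
    by metis
  have "t < pot \<kappa> \<nu> x" if x: "x \<in> (\<Inter>v\<in>V. X v)" for x
  proof -
    have Kb: "v \<in> V \<Longrightarrow> K v \<in> sets \<nu>" for v
      using V(3) finite_radon_sets[OF \<nu>] by (auto intro: borel_compact)
    have "(\<Sum>v\<in>V. c v * emeasure \<nu> (K v)) = (\<integral>\<^sup>+y. (\<Sum>v\<in>V. c v * indicator (K v) y) \<partial>\<nu>)"
      using Kb by (subst nn_integral_sum) (auto simp: nn_integral_cmult_indicator)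
    also have "\<dots> \<le> pot \<kappa> \<nu> x"
      unfolding pot_def
    proof (intro nn_integral_mono)
      fix y
      \<comment> \<open>The pieces are disjoint, so at most one summand is nonzero at
        \<open>y\<close>.\<close>
      show "(\<Sum>v\<in>V. c v * indicator (K v) y) \<le> \<kappa> x y"
      proof (cases "\<exists>v\<in>V. y \<in> K v")
        case True
        then obtain v where v: "v \<in> V" "y \<in> K v" by auto
        have "(\<Sum>w\<in>V. c w * indicator (K w) y) = (\<Sum>w\<in>{v}. c w * indicator (K w) y)"
          using V(1,2) v by (intro sum.mono_neutral_right) (auto simp: disjoint_family_on_def indicator_def)
        also have "(x, y) \<in> {z. c v < \<kappa> (fst z) (snd z)}" using X[OF v(1)] v x by blast
        then have "(\<Sum>w\<in>{v}. c w * indicator (K w) y) \<le> \<kappa> x y" using v by (simp add: less_imp_le)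
        finally show ?thesis .
      next
        case False
        then have "(\<Sum>v\<in>V. c v * indicator (K v) y) = 0" by (intro sum.neutral) (auto simp: indicator_def)
        then show ?thesis by simp
      qed
    qed
    finally show ?thesis using V by simp
  qed
  then show "\<exists>T. open T \<and> x0 \<in> T \<and> T \<subseteq> {x. t < pot \<kappa> \<nu> x}"
    using X V(1) by (intro exI[of _ "\<Inter>v\<in>V. X v"]) auto
qed

lemma pot_measurable: "finite_radon \<nu> \<Longrightarrow> pot \<kappa> \<nu> \<in> borel_measurable borel"
  by (rule borel_measurableI_greater) (simp add: pot_lsc borel_open)

lemma pot_measurable': "finite_radon \<nu> \<Longrightarrow> finite_radon \<mu> \<Longrightarrow> pot \<kappa> \<nu> \<in> borel_measurable \<mu>"
  using pot_measurable[of \<nu>] finite_radon_sets[of \<mu>] by (simp cong: measurable_cong_sets)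

lemma kap_sum_measure_left:
  assumes "\<And>i. i \<in> S \<Longrightarrow> finite_radon (\<mu> i)" "finite_radon \<nu>"
  shows "kap \<kappa> (sum_measure \<mu> S) \<nu> = (\<Sum>i. if i \<in> S then kap \<kappa> (\<mu> i) \<nu> else 0)"
  unfolding kap_def using assms
  by (intro nn_integral_sum_measure pot_measurable finite_radon_sets)

lemma kap_sum_measure_right:
  assumes "\<And>i. i \<in> S \<Longrightarrow> finite_radon (\<mu> i)" "finite_radon \<nu>"
  shows "kap \<kappa> \<nu> (sum_measure \<mu> S) = (\<Sum>i. if i \<in> S then kap \<kappa> \<nu> (\<mu> i) else 0)"
proof -
  have "kap \<kappa> \<nu> (sum_measure \<mu> S) = (\<integral>\<^sup>+x. (\<Sum>i. if i \<in> S then pot \<kappa> (\<mu> i) x else 0) \<partial>\<nu>)"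
    unfolding kap_def pot_def using assms
    by (simp add: nn_integral_sum_measure kernel_measurable finite_radon_sets)
  also have "\<dots> = (\<Sum>i. \<integral>\<^sup>+x. (if i \<in> S then pot \<kappa> (\<mu> i) x else 0) \<partial>\<nu>)"
  proof (intro nn_integral_suminf)
    show "(\<lambda>x. if i \<in> S then pot \<kappa> (\<mu> i) x else 0) \<in> borel_measurable \<nu>" for i
      using assms by (cases "i \<in> S") (auto intro: pot_measurable')
  qed
  also have "\<dots> = (\<Sum>i. if i \<in> S then kap \<kappa> \<nu> (\<mu> i) else 0)"
    by (intro suminf_cong) (auto simp: kap_def)
  finally show ?thesis .
qed

lemma kap_add_measure_left:
  assumes "finite_radon \<mu>" "finite_radon \<nu>" "finite_radon \<rho>"
  shows "kap \<kappa> (add_measure \<mu> \<nu>) \<rho> = kap \<kappa> \<mu> \<rho> + kap \<kappa> \<nu> \<rho>"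
  unfolding kap_def using assms by (intro nn_integral_add_measure pot_measurable finite_radon_sets)

lemma kap_add_measure_right:
  assumes "finite_radon \<mu>" "finite_radon \<nu>" "finite_radon \<rho>"
  shows "kap \<kappa> \<rho> (add_measure \<mu> \<nu>) = kap \<kappa> \<rho> \<mu> + kap \<kappa> \<rho> \<nu>"
proof -
  have "kap \<kappa> \<rho> (add_measure \<mu> \<nu>) = (\<integral>\<^sup>+x. pot \<kappa> \<mu> x + pot \<kappa> \<nu> x \<partial>\<rho>)"
    unfolding kap_def pot_def using assms
    by (simp add: nn_integral_add_measure kernel_measurable finite_radon_sets)
  also have "\<dots> = kap \<kappa> \<rho> \<mu> + kap \<kappa> \<rho> \<nu>"
    unfolding kap_def using assms by (intro nn_integral_add pot_measurable')
  finally show ?thesis .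
qed

lemma kap_scale_measure_left:
  assumes "finite_radon \<mu>" "finite_radon \<nu>"
  shows "kap \<kappa> (scale_measure c \<mu>) \<nu> = c * kap \<kappa> \<mu> \<nu>"
  unfolding kap_def using assms by (intro nn_integral_scale_measure pot_measurable')

lemma kap_scale_measure_right:
  assumes "finite_radon \<mu>" "finite_radon \<nu>"
  shows "kap \<kappa> \<mu> (scale_measure c \<nu>) = c * kap \<kappa> \<mu> \<nu>"
proof -
  have m: "\<kappa> x \<in> borel_measurable \<nu>" for x
    using kernel_measurable finite_radon_sets[OF assms(2)] by (simp cong: measurable_cong_sets)
  have "kap \<kappa> \<mu> (scale_measure c \<nu>) = (\<integral>\<^sup>+x. c * pot \<kappa> \<nu> x \<partial>\<mu>)"
    unfolding kap_def pot_def by (simp add: nn_integral_scale_measure m)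
  also have "\<dots> = c * kap \<kappa> \<mu> \<nu>"
    unfolding kap_def using assms by (intro nn_integral_cmult pot_measurable')
  finally show ?thesis .
qed

lemmas kap_add_measure = kap_add_measure_left kap_add_measure_right finite_radon_add_measure
lemmas kap_scale_measure = kap_scale_measure_left kap_scale_measure_right finite_radon_scale_measure

end

section \<open>Positive definiteness for pairs of bounded measures of finite energy\<close>

locale pd_kernel = lsc_kernel +
  assumes spd: "strictly_pos_def \<kappa>"
begin

text \<open>For a singular pair this is strict positive definiteness freed of subtraction: finite
  self-energies make the signed energy well defined, and equality means that it is zero.\<close>

lemma kap_singular_le:
  assumes "signed_radon (\<sigma>, \<tau>)" and fin: "kap \<kappa> \<sigma> \<sigma> < \<infinity>" "kap \<kappa> \<tau> \<tau> < \<infinity>"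
  shows "2 * kap \<kappa> \<sigma> \<tau> \<le> kap \<kappa> \<sigma> \<sigma> + kap \<kappa> \<tau> \<tau>"
    and "2 * kap \<kappa> \<sigma> \<tau> = kap \<kappa> \<sigma> \<sigma> + kap \<kappa> \<tau> \<tau> \<Longrightarrow> emeasure \<sigma> B = 0 \<and> emeasure \<tau> B = 0"
proof -
  let ?p = "kap \<kappa> \<sigma> \<sigma> + kap \<kappa> \<tau> \<tau>" and ?n = "2 * kap \<kappa> \<sigma> \<tau>"
  have p: "?p < \<infinity>" using fin by simp
  then have wd: "energy_wd \<kappa> (\<sigma>, \<tau>)" by (simp add: energy_wd_def sen_pos_def)
  have se: "senergy \<kappa> (\<sigma>, \<tau>) = enn2ereal ?p - enn2ereal ?n"
    by (simp add: senergy_def sen_pos_def sen_neg_def)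
  have "0 \<le> enn2ereal ?p - enn2ereal ?n"
    using spd assms(1) wd unfolding strictly_pos_def_def se[symmetric] by blast
  moreover obtain p' where p': "?p = ennreal p'" "0 \<le> p'" using p by (cases ?p) auto
  ultimately show le: "?n \<le> ?p"
    by (cases ?n) (auto simp: enn2ereal_ennreal ennreal_le_iff)
  assume eq: "?n = ?p"
  then have 0: "senergy \<kappa> (\<sigma>, \<tau>) = 0"
    unfolding se using p' by (simp add: enn2ereal_ennreal)
  then have "(\<sigma>, \<tau>) \<in> Ecal \<kappa>" using assms(1) wd by (simp add: Ecal_def)
  then show "emeasure \<sigma> B = 0 \<and> emeasure \<tau> B = 0"
    using spd 0 unfolding strictly_pos_def_def by force
qed

definition fin_energy :: "'a measure \<Rightarrow> bool" where
  "fin_energy \<mu> \<longleftrightarrow> finite_radon \<mu> \<and> kap \<kappa> \<mu> \<mu> < \<infinity>"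

text \<open>\<open>enn2real\<close> sends infinity to 0. By \<open>kap_finite\<close> that default
  does not occur between measures satisfying \<open>fin_energy\<close>.\<close>

definition mutual :: "'a measure \<Rightarrow> 'a measure \<Rightarrow> real" where
  "mutual \<mu> \<nu> = enn2real (kap \<kappa> \<mu> \<nu>)"

lemma mutual_nonneg: "0 \<le> mutual \<mu> \<nu>"
  by (simp add: mutual_def)

lemma fin_energy_radon: "fin_energy \<mu> \<Longrightarrow> finite_radon \<mu>"
  by (simp add: fin_energy_def)

text \<open>The energy of the sum expands into four nonnegative terms, so each of them is
  finite.\<close>

lemma fin_energy_summands:
  assumes "finite_radon \<mu>" "finite_radon \<nu>" "fin_energy (add_measure \<mu> \<nu>)"
  shows "fin_energy \<mu>" "fin_energy \<nu>" "kap \<kappa> \<mu> \<nu> < \<infinity>" "kap \<kappa> \<nu> \<mu> < \<infinity>"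
  using assms by (auto simp: fin_energy_def kap_add_measure)

text \<open>Split off the common part \<open>m\<close>. The mixed terms containing \<open>m\<close>
  already occur in the energy of \<open>P\<close> or of \<open>N\<close>, and the remaining term,
  between \<sigma> and \<tau>, is bounded by positive definiteness.\<close>

lemma kap_finite:
  assumes P: "fin_energy P" and N: "fin_energy N"
  shows "kap \<kappa> P N < \<infinity>"
proof -
  obtain \<sigma> \<tau> m where j: "finite_radon \<sigma>" "finite_radon \<tau>" "finite_radon m"
    "P = add_measure \<sigma> m" "N = add_measure \<tau> m" "signed_radon (\<sigma>, \<tau>)"
    using finite_radon_jordan[of P N] P N by (auto simp: fin_energy_def)
  note s = fin_energy_summands[OF j(1,3) P[unfolded j(4)]] fin_energy_summands[OF j(2,3) N[unfolded j(5)]]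
  have "2 * kap \<kappa> \<sigma> \<tau> < \<infinity>"
    using kap_singular_le(1)[OF j(6)] s by (auto simp: fin_energy_def intro: le_less_trans)
  then have "kap \<kappa> \<sigma> \<tau> < \<infinity>" by (auto simp: ennreal_mult_less_top)
  then show ?thesis
    using j(1-3) s by (simp add: j(4,5) kap_add_measure fin_energy_def)
qed

lemma kap_eq_mutual: "fin_energy P \<Longrightarrow> fin_energy N \<Longrightarrow> kap \<kappa> P N = ennreal (mutual P N)"
  using kap_finite[of P N] by (simp add: mutual_def less_top)

lemma fin_energy_add_measure:
  assumes "fin_energy P" "fin_energy N" shows "fin_energy (add_measure P N)"
  using assms kap_finite[of P N] kap_finite[of N P]
  by (auto simp: fin_energy_def kap_add_measure)

lemma fin_energy_scale_measure:
  assumes "fin_energy P" shows "fin_energy (scale_measure (ennreal c) P)"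
  using assms by (auto simp: fin_energy_def kap_scale_measure ennreal_mult_less_top)

lemma mutual_add_measure:
  assumes "fin_energy \<mu>" "fin_energy \<nu>" "fin_energy \<rho>"
  shows "mutual (add_measure \<mu> \<nu>) \<rho> = mutual \<mu> \<rho> + mutual \<nu> \<rho>"
    and "mutual \<rho> (add_measure \<mu> \<nu>) = mutual \<rho> \<mu> + mutual \<rho> \<nu>"
  using assms kap_finite fin_energy_radon
  by (auto simp: mutual_def kap_add_measure enn2real_plus)

lemma mutual_scale_measure:
  assumes "fin_energy \<mu>" "fin_energy \<nu>" "0 \<le> c"
  shows "mutual (scale_measure (ennreal c) \<mu>) \<nu> = c * mutual \<mu> \<nu>"
    and "mutual \<mu> (scale_measure (ennreal c) \<nu>) = c * mutual \<mu> \<nu>"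
  using assms fin_energy_radon
  by (auto simp: mutual_def kap_scale_measure enn2real_mult)

text \<open>Positive definiteness is only assumed for Jordan decompositions; it passes to arbitrary
  differences \<open>P - N\<close> because the common part of \<open>P\<close> and \<open>N\<close> cancels.  Symmetrizing the mixed
  terms avoids a Fubini theorem on the non-second-countable product.\<close>
lemma mutual_le:
  assumes P: "fin_energy P" and N: "fin_energy N"
  shows "mutual P N + mutual N P \<le> mutual P P + mutual N N"
    and "mutual P P + mutual N N \<le> mutual P N + mutual N P \<Longrightarrow> P = N"
proof -
  obtain \<sigma> \<tau> m where j: "finite_radon \<sigma>" "finite_radon \<tau>" "finite_radon m"
    "P = add_measure \<sigma> m" "N = add_measure \<tau> m" "signed_radon (\<sigma>, \<tau>)"
    using finite_radon_jordan[of P N] P N by (auto simp: fin_energy_def)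
  \<comment> \<open>Both orders of the mixed energy are to be bounded, so the swapped pair must also
    be a Jordan pair.\<close>
  have sw: "signed_radon (\<tau>, \<sigma>)"
  proof -
    obtain S where "S \<in> sets borel" "emeasure \<sigma> (UNIV - S) = 0" "emeasure \<tau> S = 0"
      using j(6) by (auto simp: signed_radon_def)
    then show ?thesis using j(6)
      by (auto simp: signed_radon_def Diff_Diff_Int intro!: bexI[of _ "UNIV - S"])
  qed
  note s = fin_energy_summands[OF j(1,3) P[unfolded j(4)]] fin_energy_summands[OF j(2,3) N[unfolded j(5)]]
  have fe: "fin_energy \<sigma>" "fin_energy \<tau>" "fin_energy m" using s by auto
  have two: "2 * kap \<kappa> \<mu> \<nu> = ennreal (2 * mutual \<mu> \<nu>)" if "fin_energy \<mu>" "fin_energy \<nu>" for \<mu> \<nu>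
    using that by (simp add: kap_eq_mutual ennreal_mult' ennreal_numeral)
  have sum: "kap \<kappa> \<sigma> \<sigma> + kap \<kappa> \<tau> \<tau> = ennreal (mutual \<sigma> \<sigma> + mutual \<tau> \<tau>)"
    using fe by (simp add: kap_eq_mutual mutual_nonneg)
  have fin: "kap \<kappa> \<sigma> \<sigma> < \<infinity>" "kap \<kappa> \<tau> \<tau> < \<infinity>" using fe by (auto simp: fin_energy_def)
  have 1: "2 * mutual \<sigma> \<tau> \<le> mutual \<sigma> \<sigma> + mutual \<tau> \<tau>"
    using kap_singular_le(1)[OF j(6) fin] unfolding sum two[OF fe(1,2)]
    by (subst (asm) ennreal_le_iff) (auto simp: mutual_nonneg)
  have 2: "2 * mutual \<tau> \<sigma> \<le> mutual \<sigma> \<sigma> + mutual \<tau> \<tau>"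
    using kap_singular_le(1)[OF sw fin(2,1)] unfolding add.commute[of "kap \<kappa> \<tau> \<tau>"] sum two[OF fe(2,1)]
    by (subst (asm) ennreal_le_iff) (auto simp: mutual_nonneg)
  have ex: "mutual P P + mutual N N - (mutual P N + mutual N P)
      = mutual \<sigma> \<sigma> + mutual \<tau> \<tau> - (mutual \<sigma> \<tau> + mutual \<tau> \<sigma>)"
    unfolding j(4,5) using fe by (simp add: mutual_add_measure fin_energy_add_measure)
  show "mutual P N + mutual N P \<le> mutual P P + mutual N N" using ex 1 2 by linarith
  assume "mutual P P + mutual N N \<le> mutual P N + mutual N P"
  \<comment> \<open>Each mixed energy is at most half of the sum of the self-energies; equality for
    their sum forces equality for each.\<close>
  then have "2 * mutual \<sigma> \<tau> = mutual \<sigma> \<sigma> + mutual \<tau> \<tau>" using ex 1 2 by linarith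
  then have "2 * kap \<kappa> \<sigma> \<tau> = kap \<kappa> \<sigma> \<sigma> + kap \<kappa> \<tau> \<tau>" using sum two[OF fe(1,2)] by simp
  then have z: "emeasure \<sigma> B = 0" "emeasure \<tau> B = 0" for B
    using kap_singular_le(2)[OF j(6) fin] by auto
  show "P = N"
    unfolding j(4,5) using j(1-3)
    by (intro measure_eqI) (auto simp: emeasure_add_measure finite_radon_sets z)
qed

text \<open>The weighted form of Cauchy-Schwarz: apply \<open>mutual_le\<close> to \<open>P\<close>
  and \<open>t\<close> times \<open>N\<close>, then divide by \<open>t\<close>. The free weight is
  chosen later to balance the two terms.\<close>

lemma mutual_le_scaled:
  assumes "fin_energy P" "fin_energy N" "0 < t"
  shows "mutual P N + mutual N P \<le> mutual P P / t + t * mutual N N"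
proof -
  have "t * (mutual P N + mutual N P) \<le> mutual P P + t * (t * mutual N N)"
    using mutual_le(1)[OF assms(1) fin_energy_scale_measure[OF assms(2)], of t] assms
    by (simp add: mutual_scale_measure fin_energy_scale_measure algebra_simps)
  then show ?thesis using assms(3) by (simp add: field_simps)
qed

end

section \<open>Vector measures\<close>

lemma radon_sets: "radon \<mu> \<Longrightarrow> sets \<mu> = sets borel"
  unfolding radon_def by (rule conjunct1)

text \<open>The complement of \<open>E\<close> is open, so inner regularity turns local
  negligibility into measure zero.\<close>

lemma concentrated_closed_iff:
  assumes \<mu>: "radon \<mu>" and E: "closed E"
  shows "concentrated \<mu> E \<longleftrightarrow> emeasure \<mu> (- E) = 0"
proof
  assume c: "concentrated \<mu> E"
  have "emeasure \<mu> (- E) = (SUP K\<in>{K. compact K \<and> K \<subseteq> - E}. emeasure \<mu> K)"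
    using \<mu> E unfolding radon_def by (elim conjE) (metis open_Compl)
  also have "\<dots> \<le> 0"
  proof (intro SUP_least, safe)
    fix K assume K: "compact K" "K \<subseteq> - E"
    then obtain N where N: "N \<in> sets borel" "K - E \<subseteq> N" "emeasure \<mu> N = 0"
      using c unfolding concentrated_def by blast
    have "emeasure \<mu> K \<le> emeasure \<mu> N"
      using N K radon_sets[OF \<mu>] by (intro emeasure_mono) auto
    then show "emeasure \<mu> K \<le> 0" using N by simp
  qed
  finally show "emeasure \<mu> (- E) = 0" by simp
next
  assume "emeasure \<mu> (- E) = 0"
  then show "concentrated \<mu> E"
    unfolding concentrated_def using E by (auto intro!: bexI[of _ "- E"])
qed

lemma continuous_on_set_nn_integrand_measurable:
  fixes g :: "'a::topological_space \<Rightarrow> real"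
  assumes "E \<in> sets borel" "continuous_on E g"
  shows "(\<lambda>x. ennreal (g x) * indicator E x) \<in> borel_measurable borel"
proof -
  have "(\<lambda>x. ennreal (indicator E x *\<^sub>R g x)) \<in> borel_measurable borel"
    using borel_measurable_continuous_on_indicator[OF assms] by measurable
  also have "(\<lambda>x. ennreal (indicator E x *\<^sub>R g x)) = (\<lambda>x. ennreal (g x) * indicator E x)"
    by (auto simp: indicator_def)
  finally show ?thesis .
qed

lemma set_nn_integral_superset:
  assumes \<mu>: "radon \<mu>" "closed E" "concentrated \<mu> E" and "E \<subseteq> F"
  shows "(\<integral>\<^sup>+x\<in>F. f x \<partial>\<mu>) = (\<integral>\<^sup>+x\<in>E. f x \<partial>\<mu>)"
proof (rule nn_integral_cong_AE)
  have "- E \<in> sets \<mu>" "emeasure \<mu> (- E) = 0"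
    using \<mu> radon_sets[OF \<mu>(1)] concentrated_closed_iff by auto
  then have "AE x in \<mu>. x \<in> E"
    by (intro AE_I'[of "- E"]) (auto simp: null_sets_def)
  then show "AE x in \<mu>. f x * indicator F x = f x * indicator E x"
    by eventually_elim (use \<open>E \<subseteq> F\<close> in \<open>auto simp: indicator_def\<close>)
qed

lemma mass_le_set_nn_integral:
  fixes g :: "'a::t2_space \<Rightarrow> real"
  assumes \<mu>: "radon \<mu>" "closed E" "concentrated \<mu> E" and c: "\<And>x. x \<in> E \<Longrightarrow> c \<le> g x"
  shows "ennreal c * emeasure \<mu> UNIV \<le> (\<integral>\<^sup>+x\<in>E. ennreal (g x) \<partial>\<mu>)"
proof -
  have s: "sets \<mu> = sets borel" using \<mu>(1) by (rule radon_sets)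
  have "emeasure \<mu> UNIV = emeasure \<mu> E + emeasure \<mu> (- E)"
    using \<mu> s by (subst plus_emeasure) auto
  also have "emeasure \<mu> (- E) = 0" using \<mu> concentrated_closed_iff by blast
  finally have "ennreal c * emeasure \<mu> UNIV = (\<integral>\<^sup>+x. ennreal c * indicator E x \<partial>\<mu>)"
    using \<mu> s by (simp add: nn_integral_cmult_indicator)
  also have "\<dots> \<le> (\<integral>\<^sup>+x\<in>E. ennreal (g x) \<partial>\<mu>)"
    using c by (intro nn_integral_mono) (auto simp: indicator_def intro: ennreal_leI)
  finally show ?thesis .
qed

section \<open>Componentwise operations on vector measures\<close>

lemma sum_measure_cong:
  assumes "\<And>i. i \<in> S \<Longrightarrow> \<mu> i = \<nu> i"
  shows "sum_measure \<mu> S = sum_measure \<nu> S"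
proof -
  have "(\<lambda>B. \<Sum>i. if i \<in> S then emeasure (\<mu> i) B else 0) = (\<lambda>B. \<Sum>i. if i \<in> S then emeasure (\<nu> i) B else 0)"
    using assms by (intro ext suminf_cong) auto
  then show ?thesis by (simp add: sum_measure_def)
qed

lemma sum_measure_add_measure:
  assumes sets: "\<And>i. i \<in> S \<Longrightarrow> sets (\<mu> i) = sets borel" "\<And>i. i \<in> L \<Longrightarrow> sets (\<nu> i) = sets borel"
    and L: "L \<subseteq> S"
  shows "sum_measure (\<lambda>i. if i \<in> L then add_measure (\<mu> i) (\<nu> i) else \<mu> i) S
      = add_measure (sum_measure \<mu> S) (sum_measure \<nu> L)"
proof (rule measure_eqI)
  fix B assume "B \<in> sets (sum_measure (\<lambda>i. if i \<in> L then add_measure (\<mu> i) (\<nu> i) else \<mu> i) S)"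
  then have B: "B \<in> sets borel" by simp
  have "emeasure (sum_measure (\<lambda>i. if i \<in> L then add_measure (\<mu> i) (\<nu> i) else \<mu> i) S) B
      = (\<Sum>i. if i \<in> S then emeasure (if i \<in> L then add_measure (\<mu> i) (\<nu> i) else \<mu> i) B else 0)"
    using B sets by (intro emeasure_sum_measure) auto
  also have "\<dots> = (\<Sum>i. (if i \<in> S then emeasure (\<mu> i) B else 0) + (if i \<in> L then emeasure (\<nu> i) B else 0))"
    using B sets L by (intro suminf_cong) (auto simp: emeasure_add_measure)
  also have "\<dots> = (\<Sum>i. if i \<in> S then emeasure (\<mu> i) B else 0) + (\<Sum>i. if i \<in> L then emeasure (\<nu> i) B else 0)"
    by (intro suminf_add[symmetric]) auto
  also have "\<dots> = emeasure (add_measure (sum_measure \<mu> S) (sum_measure \<nu> L)) B"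
    using B sets by (simp add: emeasure_add_measure emeasure_sum_measure)
  finally show "emeasure (sum_measure (\<lambda>i. if i \<in> L then add_measure (\<mu> i) (\<nu> i) else \<mu> i) S) B
      = emeasure (add_measure (sum_measure \<mu> S) (sum_measure \<nu> L)) B" .
qed simp

lemma sum_measure_scale_measure:
  assumes sets: "\<And>i. i \<in> S \<Longrightarrow> sets (\<mu> i) = sets borel"
  shows "sum_measure (\<lambda>i. scale_measure c (\<mu> i)) S = scale_measure c (sum_measure \<mu> S)"
proof (rule measure_eqI)
  fix B assume "B \<in> sets (sum_measure (\<lambda>i. scale_measure c (\<mu> i)) S)"
  then have B: "B \<in> sets borel" by simp
  have "emeasure (sum_measure (\<lambda>i. scale_measure c (\<mu> i)) S) B
      = (\<Sum>i. if i \<in> S then emeasure (scale_measure c (\<mu> i)) B else 0)"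
    using B sets by (intro emeasure_sum_measure) auto
  also have "\<dots> = (\<Sum>i. c * (if i \<in> S then emeasure (\<mu> i) B else 0))"
    by (intro suminf_cong) auto
  also have "\<dots> = emeasure (scale_measure c (sum_measure \<mu> S)) B"
    using B sets by (simp add: emeasure_sum_measure)
  finally show "emeasure (sum_measure (\<lambda>i. scale_measure c (\<mu> i)) S) B
      = emeasure (scale_measure c (sum_measure \<mu> S)) B" .
qed simp

text \<open>The nonnegative excesses \<open>x i - y i\<close> sum to zero, because a finite sum can
  be cancelled in \<open>ennreal\<close>.\<close>

lemma suminf_ennreal_eq_imp_eq:
  fixes x y :: "nat \<Rightarrow> ennreal"
  assumes le: "\<And>i. y i \<le> x i" and eq: "(\<Sum>i. x i) = (\<Sum>i. y i)" and fin: "(\<Sum>i. y i) < \<infinity>"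
  shows "x i = y i"
proof -
  have d: "x i = y i + (x i - y i)" for i using le[of i] by (simp add: add_diff_inverse_ennreal)
  have "(\<Sum>i. y i) + (\<Sum>i. x i - y i) = (\<Sum>i. y i + (x i - y i))"
    by (intro suminf_add) auto
  also have "\<dots> = (\<Sum>i. y i) + 0" using d eq by simp
  finally have "(\<Sum>i. x i - y i) = 0"
    using fin by (auto simp: ennreal_add_left_cancel)
  then have "x i - y i = 0" by (simp add: suminf_eq_zero_iff)
  then show ?thesis using d[of i] by simp
qed

section \<open>Vector measures of finite mass and energy; sets of infinite capacity\<close>

context pd_kernel
begin

lemma kap_sum_measures:
  assumes "\<And>i. i \<in> S \<Longrightarrow> finite_radon (\<mu> i)" "finite_radon (sum_measure \<mu> S)"
  shows "kap \<kappa> (sum_measure \<mu> S) (sum_measure \<mu> S)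
      = (\<Sum>i. \<Sum>j. if i \<in> S \<and> j \<in> S then kap \<kappa> (\<mu> i) (\<mu> j) else 0)"
proof -
  have "kap \<kappa> (sum_measure \<mu> S) (sum_measure \<mu> S)
      = (\<Sum>i. if i \<in> S then kap \<kappa> (\<mu> i) (sum_measure \<mu> S) else 0)"
    using assms by (intro kap_sum_measure_left) auto
  also have "\<dots> = (\<Sum>i. \<Sum>j. if i \<in> S \<and> j \<in> S then kap \<kappa> (\<mu> i) (\<mu> j) else 0)"
    using assms by (intro suminf_cong) (auto simp: kap_sum_measure_right)
  finally show ?thesis .
qed

text \<open>The energy condition concerns the sum of all components without signs. By
  \<open>kap_sum_measures\<close> that energy is the double series in \<open>Evec\<close>.\<close>

definition fin_vec :: "nat set \<Rightarrow> (nat \<Rightarrow> 'a measure) \<Rightarrow> bool" where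
  "fin_vec S \<mu> \<longleftrightarrow> (\<forall>i\<in>S. finite_radon (\<mu> i)) \<and> fin_energy (sum_measure \<mu> S)"

lemma fin_vec_sets: "fin_vec S \<mu> \<Longrightarrow> i \<in> S \<Longrightarrow> sets (\<mu> i) = sets borel"
  by (simp add: fin_vec_def finite_radon_sets)

text \<open>The kernel is nonnegative, so mass and energy of the sum grow with the index
  set.\<close>

lemma fin_vec_subset:
  assumes \<mu>: "fin_vec S \<mu>" and "T \<subseteq> S"
  shows "fin_vec T \<mu>"
proof -
  have fr: "\<And>i. i \<in> T \<Longrightarrow> finite_radon (\<mu> i)" "\<And>i. i \<in> S \<Longrightarrow> finite_radon (\<mu> i)"
    and S: "finite_radon (sum_measure \<mu> S)" "kap \<kappa> (sum_measure \<mu> S) (sum_measure \<mu> S) < \<infinity>"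
    using assms by (auto simp: fin_vec_def fin_energy_def)
  have "(\<Sum>i. if i \<in> T then emeasure (\<mu> i) UNIV else 0) \<le> (\<Sum>i. if i \<in> S then emeasure (\<mu> i) UNIV else 0)"
    using \<open>T \<subseteq> S\<close> by (intro suminf_le) auto
  also have "\<dots> = emeasure (sum_measure \<mu> S) UNIV"
    using \<mu> by (intro emeasure_sum_measure[symmetric]) (auto simp: fin_vec_sets)
  also have "\<dots> < \<infinity>" by (rule finite_radon_finite[OF S(1)])
  finally have T: "finite_radon (sum_measure \<mu> T)"
    using fr by (intro finite_radon_sum_measure)
  have "kap \<kappa> (sum_measure \<mu> T) (sum_measure \<mu> T) \<le> kap \<kappa> (sum_measure \<mu> S) (sum_measure \<mu> S)"
    using fr S T \<open>T \<subseteq> S\<close> by (auto simp: kap_sum_measures intro!: suminf_le)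
  then show ?thesis using S T fr by (auto simp: fin_vec_def fin_energy_def intro: le_less_trans)
qed

lemma fin_vecI:
  assumes \<mu>: "\<mu> \<in> Evec \<kappa> Ipos Ineg A"
    and mass: "(\<Sum>i. if i \<in> Ipos \<union> Ineg then emeasure (\<mu> i) UNIV else 0) < \<infinity>"
  shows "fin_vec (Ipos \<union> Ineg) \<mu>"
proof -
  have fr: "finite_radon (\<mu> i)" if "i \<in> Ipos \<union> Ineg" for i
  proof -
    have "(if i \<in> Ipos \<union> Ineg then emeasure (\<mu> i) UNIV else 0) < \<infinity>"
      by (rule ennreal_suminf_lessD[OF mass])
    moreover have "radon (\<mu> i)" using \<mu> that unfolding Evec_def by blast
    ultimately show ?thesis using that by (simp add: finite_radon_def)
  qed
  have sum: "finite_radon (sum_measure \<mu> (Ipos \<union> Ineg))"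
    using fr mass by (rule finite_radon_sum_measure)
  have "kap \<kappa> (sum_measure \<mu> (Ipos \<union> Ineg)) (sum_measure \<mu> (Ipos \<union> Ineg)) < \<infinity>"
  proof -
    have "kap \<kappa> (sum_measure \<mu> (Ipos \<union> Ineg)) (sum_measure \<mu> (Ipos \<union> Ineg))
      = (\<Sum>i. \<Sum>j. if i \<in> Ipos \<union> Ineg \<and> j \<in> Ipos \<union> Ineg then kap \<kappa> (\<mu> i) (\<mu> j) else 0)"
      using fr sum by (rule kap_sum_measures)
    then show ?thesis using \<mu> unfolding Evec_def by simp
  qed
  then show ?thesis using fr sum unfolding fin_vec_def fin_energy_def by blast
qed

lemma fin_vec_Evec:
  assumes \<mu>: "fin_vec (Ipos \<union> Ineg) \<mu>" and "\<And>i. i \<in> Ipos \<union> Ineg \<Longrightarrow> concentrated (\<mu> i) (A i)"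
  shows "\<mu> \<in> Evec \<kappa> Ipos Ineg A"
proof -
  have fr: "\<And>i. i \<in> Ipos \<union> Ineg \<Longrightarrow> finite_radon (\<mu> i)"
    and sum: "finite_radon (sum_measure \<mu> (Ipos \<union> Ineg))"
      "kap \<kappa> (sum_measure \<mu> (Ipos \<union> Ineg)) (sum_measure \<mu> (Ipos \<union> Ineg)) < \<infinity>"
    using \<mu> unfolding fin_vec_def fin_energy_def by blast+
  have "kap \<kappa> (sum_measure \<mu> (Ipos \<union> Ineg)) (sum_measure \<mu> (Ipos \<union> Ineg))
      = (\<Sum>i. \<Sum>j. if i \<in> Ipos \<union> Ineg \<and> j \<in> Ipos \<union> Ineg then kap \<kappa> (\<mu> i) (\<mu> j) else 0)"
    using fr sum(1) by (rule kap_sum_measures)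
  then show ?thesis
    using sum(2) assms(2) fr unfolding Evec_def finite_radon_def mem_Collect_eq by metis
qed

text \<open>Both orders of the mixed energy of the two parts are kept, which matches the symmetrized
  inequality \<open>mutual_le\<close>.\<close>

lemma Gchi_mutual:
  "Gchi \<kappa> Ipos Ineg chi \<mu> =
    (let P = sum_measure \<mu> Ipos; N = sum_measure \<mu> Ineg in
      mutual P P + mutual N N - mutual P N - mutual N P
      + 2 * (mutual (fst chi) P + mutual (snd chi) N - mutual (fst chi) N - mutual (snd chi) P))"
  by (simp add: Gchi_def skap_def Rvec_def mutual_def Let_def)

text \<open>Restricting to a compact set makes the integral of the possibly unbounded
  \<open>g\<close> finite. If at least half of the unit mass is kept, this integral is at least
  \<open>c / 2\<close>, so the rescaling factor is at most \<open>2 * b / c\<close>, however small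
  the energy was.\<close>

lemma infinite_capacity_small_energy:
  fixes g :: "'a \<Rightarrow> real"
  assumes E: "closed E" and cap: "capacity \<kappa> E = \<infinity>" and g: "continuous_on E g"
    and c: "0 < c" "\<And>x. x \<in> E \<Longrightarrow> c \<le> g x" and b: "0 \<le> b" and \<eta>: "0 < \<eta>"
  shows "\<exists>\<tau>. fin_energy \<tau> \<and> concentrated \<tau> E \<and> (\<integral>\<^sup>+x\<in>E. ennreal (g x) \<partial>\<tau>) = ennreal b \<and> mutual \<tau> \<tau> \<le> \<eta>"
proof -
  \<comment> \<open>Chosen so that rescaling by \<open>2 * b / c\<close> leaves an energy of at most
    \<eta>; the summand 1 keeps the denominator positive when \<open>b = 0\<close>.\<close>
  define \<eta>' where "\<eta>' = \<eta> / ((2 * b / c)\<^sup>2 + 1)"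
  have den: "0 < (2 * b / c)\<^sup>2 + 1" by (simp add: add_nonneg_pos)
  have \<eta>': "0 < \<eta>'" "(2 * b / c)\<^sup>2 * \<eta>' \<le> \<eta>"
    using \<eta> den by (auto simp: \<eta>'_def field_simps)
  \<comment> \<open>An infinite quotient 1 / x in \<open>ennreal\<close> forces x = 0.\<close>
  have "(INF \<nu>\<in>{\<nu>\<in>Epos_on \<kappa> E. emeasure \<nu> UNIV = 1}. kap \<kappa> \<nu> \<nu>) = 0"
    using cap unfolding capacity_def by (simp add: ennreal_divide_eq_top_iff)
  then have "(INF \<nu>\<in>{\<nu>\<in>Epos_on \<kappa> E. emeasure \<nu> UNIV = 1}. kap \<kappa> \<nu> \<nu>) < ennreal \<eta>'"
    using \<eta>' by simp
  then obtain \<nu> where \<nu>: "\<nu> \<in> Epos_on \<kappa> E" "emeasure \<nu> UNIV = 1" "kap \<kappa> \<nu> \<nu> < ennreal \<eta>'"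
    unfolding INF_less_iff by auto
  have fr: "finite_radon \<nu>" and fe: "fin_energy \<nu>"
    using \<nu> by (auto simp: Epos_on_def Epos_def finite_radon_def fin_energy_def)
  note [simp] = finite_radon_sets[OF fr]
  have nullE: "emeasure \<nu> (- E) = 0"
    using \<nu> E concentrated_closed_iff by (auto simp: Epos_on_def Epos_def)
  obtain K where K: "compact K" "emeasure \<nu> (UNIV - K) < ennreal (1/2)"
    using finite_radon_inner[OF fr, of UNIV "ennreal (1/2)"] by fastforce
  define F where "F = E \<inter> K"
  have F: "compact F" "F \<subseteq> E" "F \<in> sets borel"
    using E K by (auto simp: F_def closed_Int_compact intro!: borel_compact)
  have meas: "E \<in> sets borel" "K \<in> sets borel" using E K by (auto intro: borel_compact)
  have half: "ennreal (1/2) \<le> emeasure \<nu> F"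
  proof -
    have "emeasure \<nu> UNIV \<le> emeasure \<nu> (F \<union> (- E \<union> (UNIV - K)))"
      using meas F by (intro emeasure_mono) (auto simp: F_def)
    also have "\<dots> \<le> emeasure \<nu> F + emeasure \<nu> (- E \<union> (UNIV - K))"
      using meas F by (intro emeasure_subadditive) auto
    also have "emeasure \<nu> (- E \<union> (UNIV - K)) \<le> emeasure \<nu> (- E) + emeasure \<nu> (UNIV - K)"
      using meas F by (intro emeasure_subadditive) auto
    also have "\<dots> \<le> ennreal (1/2)" using nullE K by simp
    finally have *: "1 \<le> emeasure \<nu> F + ennreal (1/2)" using \<nu> by (simp add: add_mono)
    obtain f where f: "emeasure \<nu> F = ennreal f" "0 \<le> f"
      using finite_radon_finite[OF fr, of F] by (cases "emeasure \<nu> F") auto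
    have "ennreal 1 \<le> ennreal (f + 1/2)" using * f by (simp add: ennreal_plus)
    then have "1/2 \<le> f" using f by (subst (asm) ennreal_le_iff) auto
    then show ?thesis unfolding f(1) by (rule ennreal_leI)
  qed
  define \<rho> where "\<rho> = density \<nu> (indicator F)"
  define \<rho>' where "\<rho>' = density \<nu> (indicator (- F))"
  have F': "- F \<in> sets borel" using F by auto
  have \<rho>: "finite_radon \<rho>" "\<And>C. C \<in> sets borel \<Longrightarrow> emeasure \<rho> C = emeasure \<nu> (F \<inter> C)"
    and \<rho>': "finite_radon \<rho>'" "\<And>C. C \<in> sets borel \<Longrightarrow> emeasure \<rho>' C = emeasure \<nu> (- F \<inter> C)"
    using finite_radon_density_indicator[OF fr F(3)] finite_radon_density_indicator[OF fr F']
    by (auto simp: \<rho>_def \<rho>'_def)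
  have split: "\<nu> = add_measure \<rho> \<rho>'"
  proof (rule measure_eqI)
    fix B assume "B \<in> sets \<nu>"
    then have B: "B \<in> sets borel" by simp
    have "emeasure \<nu> (F \<inter> B) + emeasure \<nu> (- F \<inter> B) = emeasure \<nu> B"
      using B F by (subst plus_emeasure) (auto intro!: arg_cong[where f="emeasure \<nu>"])
    then show "emeasure \<nu> B = emeasure (add_measure \<rho> \<rho>') B"
      using B \<rho> \<rho>' by (simp add: emeasure_add_measure finite_radon_sets)
  qed simp
  have fe\<rho>: "fin_energy \<rho>" "fin_energy \<rho>'"
    using fin_energy_summands[OF \<rho>(1) \<rho>'(1)] fe split by auto
  \<comment> \<open>The remaining terms in the expansion of the energy of \<nu> are nonnegative, so
    restriction does not increase energy.\<close>
  have "mutual \<rho> \<rho> \<le> mutual \<nu> \<nu>"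
    unfolding split using fe\<rho> by (simp add: mutual_add_measure fin_energy_add_measure mutual_nonneg)
  also have "mutual \<nu> \<nu> \<le> \<eta>'"
    using \<nu>(3) kap_eq_mutual[OF fe fe] \<eta>' by (simp add: ennreal_less_iff mutual_nonneg)
  finally have small: "mutual \<rho> \<rho> \<le> \<eta>'" .
  have conc: "emeasure \<rho> (- E) = 0"
    using \<rho>(2)[of "- E"] E F by (simp add: Int_absorb2 Diff_eq[symmetric] Diff_eq_empty_iff[THEN iffD2])
  have gm: "(\<lambda>x. ennreal (g x) * indicator E x) \<in> borel_measurable borel"
    using E g by (intro continuous_on_set_nn_integrand_measurable) auto
  define J where "J = (\<integral>\<^sup>+x\<in>E. ennreal (g x) \<partial>\<rho>)"
  have "ennreal c * emeasure \<rho> UNIV \<le> J"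
    unfolding J_def using \<rho>(1) E conc c
    by (intro mass_le_set_nn_integral) (auto simp: finite_radon_def concentrated_closed_iff)
  moreover have "ennreal (c / 2) \<le> ennreal c * emeasure \<rho> UNIV"
  proof -
    have "ennreal (c / 2) = ennreal c * ennreal (1/2)"
      using c by (subst ennreal_mult[symmetric]) auto
    also have "\<dots> \<le> ennreal c * emeasure \<rho> UNIV" using half \<rho>(2)[of UNIV] by (intro mult_left_mono) auto
    finally show ?thesis .
  qed
  ultimately have Jge: "ennreal (c / 2) \<le> J" by simp
  have "bounded (g ` F)"
    using F g by (intro compact_imp_bounded compact_continuous_image) (auto intro: continuous_on_subset)
  then obtain m where m: "\<And>x. x \<in> F \<Longrightarrow> g x \<le> m"
    unfolding bounded_iff by (metis abs_ge_self imageI order_trans real_norm_def)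
  have "J = (\<integral>\<^sup>+x. indicator F x * (ennreal (g x) * indicator E x) \<partial>\<nu>)"
    unfolding J_def \<rho>_def using gm F by (subst nn_integral_density) (auto cong: measurable_cong_sets)
  also have "\<dots> \<le> (\<integral>\<^sup>+x. ennreal m \<partial>\<nu>)"
    using m by (intro nn_integral_mono) (auto simp: indicator_def intro: ennreal_leI)
  also have "\<dots> < \<infinity>" using finite_radon_finite[OF fr] finite_radon_space[OF fr]
    by (simp add: ennreal_mult_less_top)
  finally obtain j where j: "J = ennreal j" "0 \<le> j" by (cases J) auto
  have jc: "c / 2 \<le> j" using Jge j c by (simp add: ennreal_le_iff)
  then have j0: "0 < j" using c by linarith
  define \<tau> where "\<tau> = scale_measure (ennreal (b / j)) \<rho>"
  have q: "0 \<le> b / j" using b j0 by simp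
  have "fin_energy \<tau>" unfolding \<tau>_def using fe\<rho> by (intro fin_energy_scale_measure)
  moreover from this have "concentrated \<tau> E"
    using E conc by (subst concentrated_closed_iff) (auto simp: fin_energy_def finite_radon_def \<tau>_def)
  moreover have "(\<integral>\<^sup>+x\<in>E. ennreal (g x) \<partial>\<tau>) = ennreal b"
  proof -
    have "(\<integral>\<^sup>+x\<in>E. ennreal (g x) \<partial>\<tau>) = ennreal (b / j) * J"
      unfolding \<tau>_def J_def using gm finite_radon_sets[OF \<rho>(1)]
      by (intro nn_integral_scale_measure) (simp cong: measurable_cong_sets)
    also have "\<dots> = ennreal b" using j j0 q by (simp add: ennreal_mult[symmetric])
    finally show ?thesis .
  qed
  moreover have "mutual \<tau> \<tau> \<le> \<eta>"
  proof -
    have "mutual \<tau> \<tau> = (b / j)\<^sup>2 * mutual \<rho> \<rho>"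
      unfolding \<tau>_def using fe\<rho> q by (simp add: mutual_scale_measure fin_energy_scale_measure power2_eq_square)
    also have "\<dots> \<le> (2 * b / c)\<^sup>2 * \<eta>'"
    proof (intro mult_mono power_mono small)
      show "b / j \<le> 2 * b / c"
        using jc j0 b c mult_left_mono[OF jc b] by (simp add: field_simps)
    qed (use q mutual_nonneg in auto)
    finally show ?thesis using \<eta>' by simp
  qed
  ultimately show ?thesis by blast
qed

text \<open>The weights \<open>q i\<close> sum to 1 and the self-energies are at most \<eta> times
  their squares. Cauchy-Schwarz bounds the mixed energies by 2 * \<eta> * \<open>q i * q j\<close>,
  and the double series sums to 2 * \<eta>.\<close>

lemma fin_energy_sum_measure_small:
  assumes fe: "\<And>i. i \<in> S \<Longrightarrow> fin_energy (\<tau> i)"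
    and small: "\<And>i. i \<in> S \<Longrightarrow> mutual (\<tau> i) (\<tau> i) \<le> \<eta> * ((1/2) ^ Suc i * (1/2) ^ Suc i)"
    and mass: "(\<Sum>i. if i \<in> S then emeasure (\<tau> i) UNIV else 0) < \<infinity>" and \<eta>: "0 \<le> \<eta>"
  shows "fin_energy (sum_measure \<tau> S) \<and> mutual (sum_measure \<tau> S) (sum_measure \<tau> S) \<le> 2 * \<eta>"
proof -
  define q where "q i = (1/2::real) ^ Suc i" for i
  have q: "0 < q i" for i by (simp add: q_def)
  have qs: "q sums 1" unfolding q_def by (rule power_half_series)
  have fr: "finite_radon (sum_measure \<tau> S)"
    using fe mass by (intro finite_radon_sum_measure) (auto simp: fin_energy_def)
  have mixed: "mutual (\<tau> i) (\<tau> j) \<le> 2 * \<eta> * q i * q j" if i: "i \<in> S" and j: "j \<in> S" for i j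
  proof -
    \<comment> \<open>The weight \<open>q i / q j\<close> makes both terms at most \<eta> *
      \<open>q i * q j\<close>. Only the symmetrized mixed energy is bounded, so the other order is
      dropped as nonnegative, whence the factor 2.\<close>
    have "mutual (\<tau> i) (\<tau> j) \<le> mutual (\<tau> i) (\<tau> i) / (q i / q j) + q i / q j * mutual (\<tau> j) (\<tau> j)"
      using mutual_le_scaled[OF fe[OF i] fe[OF j], of "q i / q j"] q[of i] q[of j]
        mutual_nonneg[of "\<tau> j" "\<tau> i"] by simp
    also have "\<dots> \<le> \<eta> * (q i * q i) / (q i / q j) + q i / q j * (\<eta> * (q j * q j))"
    proof (intro add_mono divide_right_mono mult_left_mono)
      show "mutual (\<tau> i) (\<tau> i) \<le> \<eta> * (q i * q i)" "mutual (\<tau> j) (\<tau> j) \<le> \<eta> * (q j * q j)"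
        using small[OF i] small[OF j] by (simp_all only: q_def)
    qed (use less_imp_le[OF q[of i]] less_imp_le[OF q[of j]] in simp_all)
    also have "\<eta> * (q i * q i) / (q i / q j) = \<eta> * q i * q j" using q[of i] by simp
    also have "q i / q j * (\<eta> * (q j * q j)) = \<eta> * q i * q j" using q[of j] by simp
    also have "\<eta> * q i * q j + \<eta> * q i * q j = 2 * \<eta> * q i * q j" by simp
    finally show ?thesis .
  qed
  have "kap \<kappa> (sum_measure \<tau> S) (sum_measure \<tau> S)
      = (\<Sum>i. \<Sum>j. if i \<in> S \<and> j \<in> S then kap \<kappa> (\<tau> i) (\<tau> j) else 0)"
    using fe fr by (intro kap_sum_measures) (auto simp: fin_energy_def)
  also have "\<dots> \<le> (\<Sum>i. \<Sum>j. ennreal (2 * \<eta> * q i * q j))"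
  proof (intro suminf_le)
    fix i j
    show "(if i \<in> S \<and> j \<in> S then kap \<kappa> (\<tau> i) (\<tau> j) else 0) \<le> ennreal (2 * \<eta> * q i * q j)"
      using mixed[of i j] kap_eq_mutual[OF fe fe, of i j] by (simp add: ennreal_leI)
  qed auto
  also have "\<dots> = (\<Sum>i. ennreal (2 * \<eta> * q i))"
  proof (intro suminf_cong suminf_ennreal_eq)
    fix i j
    show "0 \<le> 2 * \<eta> * q i * q j" using \<eta> less_imp_le[OF q[of i]] less_imp_le[OF q[of j]] by simp
    show "(\<lambda>j. 2 * \<eta> * q i * q j) sums (2 * \<eta> * q i)"
      using sums_mult[OF qs, of "2 * \<eta> * q i"] by simp
  qed
  also have "\<dots> = ennreal (2 * \<eta>)"
  proof (rule suminf_ennreal_eq)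
    fix i
    show "0 \<le> 2 * \<eta> * q i" using \<eta> less_imp_le[OF q[of i]] by simp
    show "(\<lambda>i. 2 * \<eta> * q i) sums (2 * \<eta>)" using sums_mult[OF qs, of "2 * \<eta>"] by simp
  qed
  finally have le: "kap \<kappa> (sum_measure \<tau> S) (sum_measure \<tau> S) \<le> ennreal (2 * \<eta>)" .
  then have fe: "fin_energy (sum_measure \<tau> S)"
    using fr by (auto simp: fin_energy_def intro: le_less_trans)
  then show ?thesis using le \<eta> by (simp add: kap_eq_mutual mutual_nonneg)
qed

end

section \<open>The Gauss variational problem\<close>

text \<open>The field enters through its two parts, each of finite mass and energy, so that
  \<open>mutual\<close> expands for each of them separately; \<open>c\<close> is a positive lower
  bound of \<open>g\<close> on the plates.\<close>

locale gauss_problem = pd_kernel \<kappa> for \<kappa> :: "'a::t2_space \<Rightarrow> 'a \<Rightarrow> ennreal" +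
  fixes Ipos Ineg :: "nat set" and A :: "nat \<Rightarrow> 'a set" and chi :: "'a measure \<times> 'a measure"
    and g :: "'a \<Rightarrow> real" and a :: "nat \<Rightarrow> real" and c :: real
  assumes I_disjoint: "Ipos \<inter> Ineg = {}"
    and A_closed: "i \<in> Ipos \<union> Ineg \<Longrightarrow> closed (A i)"
    and A_disjoint: "i \<in> Ipos \<Longrightarrow> j \<in> Ineg \<Longrightarrow> A i \<inter> A j = {}"
    and chi_energy: "fin_energy (fst chi)" "fin_energy (snd chi)"
    and g_continuous: "continuous_on (\<Union>i\<in>Ipos \<union> Ineg. A i) g"
    and c_pos: "0 < c"
    and g_ge: "i \<in> Ipos \<union> Ineg \<Longrightarrow> x \<in> A i \<Longrightarrow> c \<le> g x"
    and a_nonneg: "i \<in> Ipos \<union> Ineg \<Longrightarrow> 0 \<le> a i"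
    and a_summable: "summable (\<lambda>i. if i \<in> Ipos \<union> Ineg then a i else 0)"
begin

section \<open>Charges, masses and admissibility\<close>

abbreviation Iall :: "nat set" where "Iall \<equiv> Ipos \<union> Ineg"

abbreviation charge :: "'a measure \<Rightarrow> nat \<Rightarrow> ennreal" where
  "charge \<mu> i \<equiv> \<integral>\<^sup>+x\<in>A i. ennreal (g x) \<partial>\<mu>"

lemma integrand_measurable:
  "i \<in> Iall \<Longrightarrow> (\<lambda>x. ennreal (g x) * indicator (A i) x) \<in> borel_measurable borel"
  using A_closed[of i] g_continuous
  by (intro continuous_on_set_nn_integrand_measurable) (auto intro: continuous_on_subset)

lemma suminf_a_finite: "(\<Sum>i. if i \<in> Iall then ennreal (a i) else 0) < \<infinity>"
proof -
  have "(\<Sum>i. if i \<in> Iall then ennreal (a i) else 0) = (\<Sum>i. ennreal (if i \<in> Iall then a i else 0))"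
    by (intro suminf_cong) auto
  also have "\<dots> = ennreal (\<Sum>i. if i \<in> Iall then a i else 0)"
    using a_nonneg a_summable by (intro suminf_ennreal2) auto
  finally show ?thesis by simp
qed

text \<open>Termwise, \<open>c\<close> times the mass is at most the charge and hence at most
  \<open>a i\<close>, which is summable.\<close>

lemma suminf_mass_finite:
  assumes S: "S \<subseteq> Iall"
    and \<mu>: "\<And>i. i \<in> S \<Longrightarrow> radon (\<mu> i)" "\<And>i. i \<in> S \<Longrightarrow> concentrated (\<mu> i) (A i)"
    and le: "\<And>i. i \<in> S \<Longrightarrow> charge (\<mu> i) i \<le> ennreal (a i)"
  shows "(\<Sum>i. if i \<in> S then emeasure (\<mu> i) UNIV else 0) < \<infinity>"
proof -
  have "ennreal c * (\<Sum>i. if i \<in> S then emeasure (\<mu> i) UNIV else 0)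
      = (\<Sum>i. ennreal c * (if i \<in> S then emeasure (\<mu> i) UNIV else 0))" by simp
  also have "\<dots> \<le> (\<Sum>i. if i \<in> Iall then ennreal (a i) else 0)"
  proof (intro suminf_le)
    fix i
    have "ennreal c * emeasure (\<mu> i) UNIV \<le> ennreal (a i)" if i: "i \<in> S"
    proof -
      have "ennreal c * emeasure (\<mu> i) UNIV \<le> charge (\<mu> i) i"
        using i S \<mu> A_closed g_ge[of i] by (intro mass_le_set_nn_integral) auto
      also note le[OF i]
      finally show ?thesis .
    qed
    then show "ennreal c * (if i \<in> S then emeasure (\<mu> i) UNIV else 0) \<le> (if i \<in> Iall then ennreal (a i) else 0)"
      using S by auto
  qed auto
  also have "\<dots> < \<infinity>" by (rule suminf_a_finite)
  finally show ?thesis using c_pos by (auto simp: ennreal_mult_less_top)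
qed

lemma fin_vec_charges:
  assumes \<mu>: "\<mu> \<in> Evec \<kappa> Ipos Ineg A" and le: "\<And>i. i \<in> Iall \<Longrightarrow> charge (\<mu> i) i \<le> ennreal (a i)"
  shows "fin_vec Iall \<mu>"
  using \<mu> le by (intro fin_vecI suminf_mass_finite) (auto simp: Evec_def)

lemma Evec_concentrated: "\<mu> \<in> Evec \<kappa> Ipos Ineg A \<Longrightarrow> i \<in> Iall \<Longrightarrow> concentrated (\<mu> i) (A i)"
  by (auto simp: Evec_def)

lemma concentrated_null:
  assumes "fin_vec Iall \<mu>" "i \<in> Iall"
  shows "concentrated (\<mu> i) (A i) \<longleftrightarrow> emeasure (\<mu> i) (- A i) = 0"
  using assms A_closed by (intro concentrated_closed_iff) (auto simp: fin_vec_def finite_radon_def)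

text \<open>The missing charges on \<open>L\<close> are supplied by a perturbation \<open>T\<close>
  of energy at most the square of \<epsilon>. It changes the functional by at most \<epsilon> *
  \<open>C\<close> with \<open>C\<close> independent of \<epsilon>, and \<epsilon> can be taken
  arbitrarily small.\<close>

lemma Ginf_infinite_capacity_le:
  assumes L: "L \<subseteq> Ineg" "\<And>l. l \<in> L \<Longrightarrow> capacity \<kappa> (A l) = \<infinity>"
    and lam: "lam \<in> Evec \<kappa> Ipos Ineg A"
    and eq: "\<And>i. i \<in> Iall - L \<Longrightarrow> charge (lam i) i = ennreal (a i)"
    and le: "\<And>l. l \<in> L \<Longrightarrow> charge (lam l) l \<le> ennreal (a l)"
  shows "Ginf \<kappa> Ipos Ineg A a g chi Iall \<le> ereal (Gchi \<kappa> Ipos Ineg chi lam)"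
proof -
  have fv: "fin_vec Iall lam"
    using lam eq le by (intro fin_vec_charges) (metis Diff_iff order_refl)+
  have LI: "L \<subseteq> Iall" using L by auto
  define P where "P = sum_measure lam Ipos"
  define N where "N = sum_measure lam Ineg"
  have fe: "fin_energy P" "fin_energy N"
    using fin_vec_subset[OF fv, of Ipos] fin_vec_subset[OF fv, of Ineg]
    by (auto simp: P_def N_def fin_vec_def)
  \<comment> \<open>The three summands bound, up to the factor \<epsilon>, the energy of
    \<open>T\<close>, its mixed energy with \<open>N\<close>, and its interaction with the negative
    part of the field.\<close>
  define C where "C = 1 + (mutual N N + 1) + 2 * (mutual (snd chi) (snd chi) + 1)"
  have C: "0 < C" unfolding C_def using mutual_nonneg[of N N] mutual_nonneg[of "snd chi" "snd chi"] by simp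
  have step: "Ginf \<kappa> Ipos Ineg A a g chi Iall \<le> ereal (Gchi \<kappa> Ipos Ineg chi lam + \<epsilon> * C)"
    if \<epsilon>: "0 < \<epsilon>" "\<epsilon> \<le> 1" for \<epsilon>
  proof -
    define b where "b l = a l - enn2real (charge (lam l) l)" for l
    have b: "0 \<le> b l" "charge (lam l) l + ennreal (b l) = ennreal (a l)" if l: "l \<in> L" for l
    proof -
      obtain r where r: "charge (lam l) l = ennreal r" "0 \<le> r"
        using le[OF l] by (cases "charge (lam l) l") (auto simp: top_unique)
      have "r \<le> a l" using le[OF l] r a_nonneg[of l] LI l by (auto simp: ennreal_le_iff)
      then show "0 \<le> b l" "charge (lam l) l + ennreal (b l) = ennreal (a l)"
        using r by (auto simp: b_def ennreal_plus[symmetric] simp del: ennreal_plus)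
    qed
    \<comment> \<open>Half of the square of \<epsilon>, because
      \<open>fin_energy_sum_measure_small\<close> doubles the bound.\<close>
    define \<eta> where "\<eta> = \<epsilon>\<^sup>2 / 2"
    have \<eta>: "0 < \<eta>" using \<epsilon> by (simp add: \<eta>_def)
    have "\<exists>\<tau>. fin_energy \<tau> \<and> concentrated \<tau> (A l) \<and> charge \<tau> l = ennreal (b l)
        \<and> mutual \<tau> \<tau> \<le> \<eta> * ((1/2) ^ Suc l * (1/2) ^ Suc l)" if l: "l \<in> L" for l
      using l L LI A_closed[of l] g_continuous c_pos g_ge[of l] b \<eta>
      by (intro infinite_capacity_small_energy[where c=c]) (auto intro: continuous_on_subset)
    then have "\<forall>l\<in>L. \<exists>\<tau>. fin_energy \<tau> \<and> concentrated \<tau> (A l) \<and> charge \<tau> l = ennreal (b l)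
        \<and> mutual \<tau> \<tau> \<le> \<eta> * ((1/2) ^ Suc l * (1/2) ^ Suc l)" by (intro ballI)
    from bchoice[OF this] obtain \<tau> where "\<forall>l\<in>L. fin_energy (\<tau> l) \<and> concentrated (\<tau> l) (A l)
        \<and> charge (\<tau> l) l = ennreal (b l)
        \<and> mutual (\<tau> l) (\<tau> l) \<le> \<eta> * ((1/2) ^ Suc l * (1/2) ^ Suc l)" by (elim exE)
    then have \<tau>: "\<And>l. l \<in> L \<Longrightarrow> fin_energy (\<tau> l)" "\<And>l. l \<in> L \<Longrightarrow> concentrated (\<tau> l) (A l)"
      "\<And>l. l \<in> L \<Longrightarrow> charge (\<tau> l) l = ennreal (b l)"
      "\<And>l. l \<in> L \<Longrightarrow> mutual (\<tau> l) (\<tau> l) \<le> \<eta> * ((1/2) ^ Suc l * (1/2) ^ Suc l)"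
      by blast+
    have \<tau>sets: "sets (\<tau> l) = sets borel" if "l \<in> L" for l
      using \<tau>(1)[OF that] finite_radon_sets by (auto simp: fin_energy_def)
    \<comment> \<open>The missing charges are dominated by \<open>a\<close>, so the added masses are
      summable by \<open>suminf_mass_finite\<close>.\<close>
    have ble: "b l \<le> a l" for l by (simp add: b_def)
    have mass: "(\<Sum>i. if i \<in> L then emeasure (\<tau> i) UNIV else 0) < \<infinity>"
      using LI \<tau>(1-3) ble
      by (intro suminf_mass_finite) (auto simp: fin_energy_def finite_radon_def intro: ennreal_leI)
    define T where "T = sum_measure \<tau> L"
    have T: "fin_energy T" "mutual T T \<le> \<epsilon>\<^sup>2"
      using fin_energy_sum_measure_small[OF \<tau>(1) \<tau>(4) mass] \<eta> by (auto simp: T_def \<eta>_def)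
    define \<mu> where "\<mu> = (\<lambda>i. if i \<in> L then add_measure (lam i) (\<tau> i) else lam i)"
    have sum: "sum_measure \<mu> S = add_measure (sum_measure lam S) T" if "L \<subseteq> S" "S \<subseteq> Iall" for S
      unfolding \<mu>_def T_def using that fv \<tau>sets
      by (intro sum_measure_add_measure) (auto simp: fin_vec_sets)
    have sumI: "sum_measure \<mu> Iall = add_measure (sum_measure lam Iall) T"
      and sumN: "sum_measure \<mu> Ineg = add_measure N T"
      using sum[of Iall] sum[of Ineg] L LI by (auto simp: N_def)
    \<comment> \<open>\<open>L\<close> lies in \<open>Ineg\<close>, so the positive part stays
      unchanged.\<close>
    have sumP: "sum_measure \<mu> Ipos = P"
      unfolding P_def using L I_disjoint by (intro sum_measure_cong) (auto simp: \<mu>_def)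
    have \<mu>fv: "fin_vec Iall \<mu>"
      unfolding fin_vec_def sumI using fv T \<tau>(1)
      by (auto simp: \<mu>_def fin_vec_def fin_energy_def[of "\<tau> _"] intro: fin_energy_add_measure finite_radon_add_measure)
    have conc: "concentrated (\<mu> i) (A i)" if i: "i \<in> Iall" for i
    proof (cases "i \<in> L")
      case True
      have "emeasure (lam i) (- A i) = 0"
        using concentrated_null[OF fv i] Evec_concentrated[OF lam i] by blast
      moreover have "emeasure (\<tau> i) (- A i) = 0"
        using concentrated_closed_iff[OF _ A_closed[OF i]] \<tau>(1,2)[OF True]
        by (auto simp: fin_energy_def finite_radon_def)
      ultimately show ?thesis
        using True i A_closed[OF i] fin_vec_sets[OF fv i] \<tau>sets
        by (subst concentrated_null[OF \<mu>fv i]) (simp add: \<mu>_def emeasure_add_measure)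
    next
      case False
      then show ?thesis using Evec_concentrated[OF lam i] by (simp add: \<mu>_def)
    qed
    have "charge (\<mu> i) i = ennreal (a i)" if i: "i \<in> Iall" for i
    proof (cases "i \<in> L")
      case True
      have "charge (\<mu> i) i = charge (lam i) i + charge (\<tau> i) i"
        using True i fin_vec_sets[OF fv i] \<tau>sets integrand_measurable[OF i]
        by (simp add: \<mu>_def nn_integral_add_measure)
      then show ?thesis using \<tau>(3) b True by simp
    next
      case False
      then show ?thesis using eq i by (simp add: \<mu>_def)
    qed
    then have "\<mu> \<in> Eadm \<kappa> Ipos Ineg A a g Iall"
      unfolding Eadm_def using fin_vec_Evec[OF \<mu>fv conc] by blast
    then have "Ginf \<kappa> Ipos Ineg A a g chi Iall \<le> ereal (Gchi \<kappa> Ipos Ineg chi \<mu>)"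
      unfolding Ginf_def by (rule INF_lower)
    also have "Gchi \<kappa> Ipos Ineg chi \<mu> \<le> Gchi \<kappa> Ipos Ineg chi lam + \<epsilon> * C"
    proof -
      have cross: "mutual Q T + mutual T Q \<le> \<epsilon> * (mutual Q Q + 1)" if Q: "fin_energy Q" for Q
      proof -
        \<comment> \<open>The weight 1 / \<epsilon> balances the energy of \<open>Q\<close> against
          that of \<open>T\<close>, giving a bound linear in \<epsilon>.\<close>
        have "mutual Q T + mutual T Q \<le> mutual Q Q / (1 / \<epsilon>) + 1 / \<epsilon> * mutual T T"
          using \<epsilon> by (intro mutual_le_scaled Q T) auto
        also have "\<dots> \<le> mutual Q Q / (1 / \<epsilon>) + 1 / \<epsilon> * \<epsilon>\<^sup>2"
          using \<epsilon> T by (intro add_left_mono mult_left_mono) auto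
        also have "\<dots> = \<epsilon> * (mutual Q Q + 1)" using \<epsilon> by (simp add: power2_eq_square algebra_simps)
        finally show ?thesis .
      qed
      have "\<epsilon>\<^sup>2 \<le> \<epsilon> * 1" unfolding power2_eq_square using \<epsilon> by (intro mult_left_mono) auto
      then have TT: "mutual T T \<le> \<epsilon>" using T by simp
      have "Gchi \<kappa> Ipos Ineg chi \<mu> = Gchi \<kappa> Ipos Ineg chi lam + mutual T T + (mutual N T + mutual T N)
          - (mutual P T + mutual T P) + 2 * (mutual (snd chi) T - mutual (fst chi) T)"
        unfolding Gchi_mutual Let_def sumP sumN P_def[symmetric] N_def[symmetric]
        using fe T chi_energy by (simp add: mutual_add_measure fin_energy_add_measure)
      \<comment> \<open>Naming the two products leaves a linear inequality. The terms of
        \<open>T\<close> with \<open>P\<close> and with \<open>fst chi\<close> carry a minus sign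
        and are dropped.\<close>
      also define u v where "u = \<epsilon> * (mutual N N + 1)" and "v = \<epsilon> * (mutual (snd chi) (snd chi) + 1)"
      have "Gchi \<kappa> Ipos Ineg chi lam + mutual T T + (mutual N T + mutual T N)
          - (mutual P T + mutual T P) + 2 * (mutual (snd chi) T - mutual (fst chi) T)
          \<le> Gchi \<kappa> Ipos Ineg chi lam + \<epsilon> + u + 2 * v"
        using TT cross[OF fe(2), folded u_def] cross[OF chi_energy(2), folded v_def] mutual_nonneg[of P T] mutual_nonneg[of T P]
          mutual_nonneg[of T "snd chi"] mutual_nonneg[of "fst chi" T] by argo
      also have "\<dots> = Gchi \<kappa> Ipos Ineg chi lam + \<epsilon> * C"
        by (simp add: C_def u_def v_def algebra_simps)
      finally show ?thesis .
    qed
    finally show ?thesis by simp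
  qed
  show ?thesis
  proof (rule ereal_le_epsilon)
    fix e :: ereal assume e: "0 < e"
    obtain r where r: "0 < r" "r \<le> 1" "ereal (r * C) \<le> e"
    proof (cases e)
      case (real s)
      then have "min 1 (s / C) * C \<le> s / C * C" using C by (intro mult_right_mono) auto
      then show ?thesis using real e C by (intro that[of "min 1 (s / C)"]) auto
    qed (use e that[of 1] in auto)
    have "Ginf \<kappa> Ipos Ineg A a g chi Iall \<le> ereal (Gchi \<kappa> Ipos Ineg chi lam + r * C)"
      by (rule step[OF r(1,2)])
    also have "\<dots> = ereal (Gchi \<kappa> Ipos Ineg chi lam) + ereal (r * C)" by simp
    also have "\<dots> \<le> ereal (Gchi \<kappa> Ipos Ineg chi lam) + e" using r(3) by (rule add_left_mono)
    finally show "Ginf \<kappa> Ipos Ineg A a g chi Iall \<le> ereal (Gchi \<kappa> Ipos Ineg chi lam) + e" .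
  qed
qed

text \<open>Strict convexity only determines the signed sum \<open>R\<mu>\<close> of a minimizer, not its components,
  since the plates of equal sign may overlap; so the negative parts agree only after summation.\<close>
lemma minimizer_negative_part_unique:
  assumes sol: "is_solution \<kappa> Ipos Ineg A a g chi J \<mu>" "is_solution \<kappa> Ipos Ineg A a g chi J \<nu>"
    and fv: "fin_vec Iall \<mu>" "fin_vec Iall \<nu>" and J: "J \<subseteq> Iall"
  shows "sum_measure \<mu> Ineg = sum_measure \<nu> Ineg"
proof -
  have ev: "\<mu> \<in> Evec \<kappa> Ipos Ineg A" "\<nu> \<in> Evec \<kappa> Ipos Ineg A"
    using sol by (auto simp: is_solution_def Eadm_def)
  define P N P' N' where "P = sum_measure \<mu> Ipos" and "N = sum_measure \<mu> Ineg"
    and "P' = sum_measure \<nu> Ipos" and "N' = sum_measure \<nu> Ineg"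
  have fe: "fin_energy P" "fin_energy N" "fin_energy P'" "fin_energy N'"
    using fin_vec_subset[OF fv(1), of Ipos] fin_vec_subset[OF fv(1), of Ineg]
      fin_vec_subset[OF fv(2), of Ipos] fin_vec_subset[OF fv(2), of Ineg]
    by (auto simp: P_def N_def P'_def N'_def fin_vec_def)
  have sets: "sets (\<mu> i) = sets borel" "sets (\<nu> i) = sets borel" if "i \<in> Iall" for i
    using that fv by (auto simp: fin_vec_sets)
  \<comment> \<open>The midpoint of the two minimizers; the \<open>if\<close> gives it the shape
    required by \<open>sum_measure_add_measure\<close>.\<close>
  define mid where "mid = (\<lambda>i. scale_measure (ennreal (1/2)) (if i \<in> Iall then add_measure (\<mu> i) (\<nu> i) else \<mu> i))"
  have sum: "sum_measure mid S = scale_measure (ennreal (1/2)) (add_measure (sum_measure \<mu> S) (sum_measure \<nu> S))"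
    if S: "S \<subseteq> Iall" for S
  proof -
    have "sum_measure mid S
        = scale_measure (ennreal (1/2)) (sum_measure (\<lambda>i. if i \<in> Iall then add_measure (\<mu> i) (\<nu> i) else \<mu> i) S)"
      unfolding mid_def using S sets by (intro sum_measure_scale_measure) auto
    also have "sum_measure (\<lambda>i. if i \<in> Iall then add_measure (\<mu> i) (\<nu> i) else \<mu> i) S
        = sum_measure (\<lambda>i. if i \<in> S then add_measure (\<mu> i) (\<nu> i) else \<mu> i) S"
      using S by (intro sum_measure_cong) auto
    also have "\<dots> = add_measure (sum_measure \<mu> S) (sum_measure \<nu> S)"
      using S sets by (intro sum_measure_add_measure) auto
    finally show ?thesis .
  qed
  have midfv: "fin_vec Iall mid"
    unfolding fin_vec_def sum[OF order_refl]
  proof (intro conjI ballI)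
    show "finite_radon (mid i)" if "i \<in> Iall" for i
      using that fv unfolding mid_def fin_vec_def
      by (simp only: if_True finite_radon_add_measure finite_radon_scale_measure)
    show "fin_energy (scale_measure (ennreal (1/2)) (add_measure (sum_measure \<mu> Iall) (sum_measure \<nu> Iall)))"
      using fv unfolding fin_vec_def by (intro fin_energy_scale_measure fin_energy_add_measure) auto
  qed
  have conc: "concentrated (mid i) (A i)" if i: "i \<in> Iall" for i
  proof -
    have "emeasure (\<mu> i) (- A i) = 0" "emeasure (\<nu> i) (- A i) = 0"
      using concentrated_null[OF fv(1) i] concentrated_null[OF fv(2) i] Evec_concentrated[OF ev(1) i]
        Evec_concentrated[OF ev(2) i] by blast+
    then show ?thesis
      using i sets A_closed[OF i]
      by (subst concentrated_null[OF midfv i]) (simp add: mid_def emeasure_add_measure)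
  qed
  have "charge (mid i) i = ennreal (a i)" if i: "i \<in> J" for i
  proof -
    have iI: "i \<in> Iall" using i J by auto
    have "charge (\<mu> i) i = ennreal (a i)" "charge (\<nu> i) i = ennreal (a i)"
      using i sol by (auto simp: is_solution_def Eadm_def)
    moreover have "charge (mid i) i = ennreal (1/2) * (charge (\<mu> i) i + charge (\<nu> i) i)"
    proof -
      have "(\<lambda>x. ennreal (g x) * indicator (A i) x) \<in> borel_measurable (add_measure (\<mu> i) (\<nu> i))"
        using integrand_measurable[OF iI] by (simp cong: measurable_cong_sets)
      then have "charge (mid i) i = ennreal (1/2) * charge (add_measure (\<mu> i) (\<nu> i)) i"
        using iI unfolding mid_def by (simp only: if_True nn_integral_scale_measure)
      also have "charge (add_measure (\<mu> i) (\<nu> i)) i = charge (\<mu> i) i + charge (\<nu> i) i"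
        using iI sets by (intro nn_integral_add_measure integrand_measurable) auto
      finally show ?thesis .
    qed
    moreover have "ennreal (1/2) * (ennreal (a i) + ennreal (a i)) = ennreal (1/2 * (a i + a i))"
      unfolding ennreal_plus[OF a_nonneg[OF iI] a_nonneg[OF iI], symmetric]
      using a_nonneg[OF iI] by (intro ennreal_mult[symmetric]) auto
    ultimately show ?thesis by simp
  qed
  then have "mid \<in> Eadm \<kappa> Ipos Ineg A a g J"
    unfolding Eadm_def using fin_vec_Evec[OF midfv conc] by blast
  then have "Ginf \<kappa> Ipos Ineg A a g chi J \<le> ereal (Gchi \<kappa> Ipos Ineg chi mid)"
    unfolding Ginf_def by (rule INF_lower)
  then have "ereal (Gchi \<kappa> Ipos Ineg chi \<mu>) \<le> ereal (Gchi \<kappa> Ipos Ineg chi mid)"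
    "ereal (Gchi \<kappa> Ipos Ineg chi \<nu>) \<le> ereal (Gchi \<kappa> Ipos Ineg chi mid)"
    using sol by (simp_all add: is_solution_def)
  then have G: "Gchi \<kappa> Ipos Ineg chi \<mu> + Gchi \<kappa> Ipos Ineg chi \<nu> \<le> 2 * Gchi \<kappa> Ipos Ineg chi mid"
    by simp
  \<comment> \<open>The difference of the two signed sums is (\<open>P\<close> - \<open>N\<close>) -
    (\<open>P'\<close> - \<open>N'\<close>) = \<open>U\<close> - \<open>V\<close>, a difference of
    positive measures to which \<open>mutual_le\<close> applies.\<close>
  define U V where "U = add_measure P N'" and "V = add_measure P' N"
  have feUV: "fin_energy U" "fin_energy V"
    using fe by (auto simp: U_def V_def intro: fin_energy_add_measure)
  have midP: "sum_measure mid Ipos = scale_measure (ennreal (1/2)) (add_measure P P')"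
    and midN: "sum_measure mid Ineg = scale_measure (ennreal (1/2)) (add_measure N N')"
    using sum[of Ipos] sum[of Ineg] by (auto simp: P_def N_def P'_def N'_def)
  have scale: "mutual (scale_measure (ennreal (1/2)) R) R' = mutual R R' / 2"
    "mutual R (scale_measure (ennreal (1/2)) R') = mutual R R' / 2"
    if "fin_energy R" "fin_energy R'" for R R'
    using mutual_scale_measure[OF that, of "1/2"] by simp_all
  \<comment> \<open>Parallelogram identity: the field terms are linear and cancel, so the midpoint
    gains half of the squared norm of \<open>U - V\<close>. Minimality forces this gain to be
    zero.\<close>
  have "4 * (2 * Gchi \<kappa> Ipos Ineg chi mid) = 4 * (Gchi \<kappa> Ipos Ineg chi \<mu> + Gchi \<kappa> Ipos Ineg chi \<nu>)
      - 2 * (mutual U U + mutual V V - (mutual U V + mutual V U))"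
    unfolding Gchi_mutual Let_def midP midN P_def[symmetric] N_def[symmetric] P'_def[symmetric]
      N'_def[symmetric] U_def V_def using fe chi_energy
    by (simp only: mutual_add_measure fin_energy_add_measure fin_energy_scale_measure scale)
       (simp add: add_divide_distrib algebra_simps)
  then have "mutual U U + mutual V V \<le> mutual U V + mutual V U" using G by argo
  then have UV: "U = V" by (rule mutual_le(2)[OF feUV])
  \<comment> \<open>On the union of the negative plates both \<open>P\<close> and \<open>P'\<close>
    vanish, since positive and negative plates are disjoint; there \<open>U = V\<close> reduces to
    \<open>N' = N\<close>.\<close>
  define An where "An = (\<Union>j\<in>Ineg. A j)"
  have An: "An \<in> sets borel" unfolding An_def using A_closed by (intro sets.countable_UN'') auto
  have Pnull: "emeasure (sum_measure \<rho> Ipos) An = 0" and Nnull: "emeasure (sum_measure \<rho> Ineg) (- An) = 0"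
    if \<rho>: "fin_vec Iall \<rho>" "\<rho> \<in> Evec \<kappa> Ipos Ineg A" for \<rho>
  proof -
    have null: "emeasure (\<rho> i) B = 0" if i: "i \<in> Iall" and B: "B \<subseteq> - A i" for i B
    proof -
      have "emeasure (\<rho> i) B \<le> emeasure (\<rho> i) (- A i)"
        using B A_closed[OF i] fin_vec_sets[OF \<rho>(1) i] by (intro emeasure_mono) auto
      then show ?thesis
        using concentrated_null[OF \<rho>(1) i] Evec_concentrated[OF \<rho>(2) i] by simp
    qed
    have "(\<Sum>i. if i \<in> Ipos then emeasure (\<rho> i) An else 0) = (\<Sum>i::nat. 0)"
      using A_disjoint by (intro suminf_cong) (auto simp: An_def intro!: null)
    then show "emeasure (sum_measure \<rho> Ipos) An = 0"
      using An \<rho> by (subst emeasure_sum_measure) (auto simp: fin_vec_sets)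
    have "(\<Sum>i. if i \<in> Ineg then emeasure (\<rho> i) (- An) else 0) = (\<Sum>i::nat. 0)"
      by (intro suminf_cong) (auto simp: An_def intro!: null)
    then show "emeasure (sum_measure \<rho> Ineg) (- An) = 0"
      using An \<rho> by (subst emeasure_sum_measure) (auto simp: fin_vec_sets)
  qed
  show ?thesis
  proof (rule measure_eqI)
    fix B assume "B \<in> sets (sum_measure \<mu> Ineg)"
    then have B: "B \<in> sets borel" by simp
    have part: "emeasure M B = emeasure M (B \<inter> An)"
      if "emeasure M (- An) = 0" "sets M = sets borel" for M
    proof -
      have "emeasure M (B - An) \<le> emeasure M (- An)" using that An by (intro emeasure_mono) auto
      then have "emeasure M (B - An) = 0" using that by simp
      moreover have "emeasure M B = emeasure M (B \<inter> An) + emeasure M (B - An)"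
        using that An B by (subst plus_emeasure) (auto intro!: arg_cong[where f="emeasure M"])
      ultimately show ?thesis by simp
    qed
    have z: "emeasure P (B \<inter> An) = 0" "emeasure P' (B \<inter> An) = 0"
      using emeasure_mono[of "B \<inter> An" An P] emeasure_mono[of "B \<inter> An" An P'] An
        Pnull[OF fv(1) ev(1)] Pnull[OF fv(2) ev(2)] by (auto simp: P_def P'_def)
    have "emeasure U (B \<inter> An) = emeasure V (B \<inter> An)" using UV by simp
    then have "emeasure N' (B \<inter> An) = emeasure N (B \<inter> An)"
      using B An z by (simp add: U_def V_def P_def N_def P'_def N'_def emeasure_add_measure)
    then show "emeasure (sum_measure \<mu> Ineg) B = emeasure (sum_measure \<nu> Ineg) B"
      using part[OF Nnull[OF fv(1) ev(1)]] part[OF Nnull[OF fv(2) ev(2)]] by (simp add: N_def N'_def)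
  qed simp
qed

text \<open>The left side depends only on the summed negative part. Enlarging the domain from
  \<open>A i\<close> to the union changes no charge, even if plates overlap, because each component
  is null off its own plate.\<close>

lemma suminf_negative_charges:
  assumes \<mu>: "fin_vec Iall \<mu>" "\<mu> \<in> Evec \<kappa> Ipos Ineg A"
  shows "(\<integral>\<^sup>+x\<in>(\<Union>j\<in>Ineg. A j). ennreal (g x) \<partial>sum_measure \<mu> Ineg)
    = (\<Sum>i. if i \<in> Ineg then charge (\<mu> i) i else 0)"
proof -
  let ?An = "\<Union>j\<in>Ineg. A j"
  have An: "?An \<in> sets borel" using A_closed by (intro sets.countable_UN'') auto
  have m: "(\<lambda>x. ennreal (g x) * indicator ?An x) \<in> borel_measurable borel"
    using An g_continuous
    by (intro continuous_on_set_nn_integrand_measurable) (auto intro: continuous_on_subset)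
  have "(\<integral>\<^sup>+x\<in>?An. ennreal (g x) \<partial>sum_measure \<mu> Ineg)
      = (\<Sum>i. if i \<in> Ineg then \<integral>\<^sup>+x\<in>?An. ennreal (g x) \<partial>\<mu> i else 0)"
    using m \<mu> by (intro nn_integral_sum_measure) (auto simp: fin_vec_sets)
  also have "\<dots> = (\<Sum>i. if i \<in> Ineg then charge (\<mu> i) i else 0)"
  proof (intro suminf_cong if_cong refl)
    fix i assume i: "i \<in> Ineg"
    show "(\<integral>\<^sup>+x\<in>?An. ennreal (g x) \<partial>\<mu> i) = charge (\<mu> i) i"
      using i \<mu> A_closed Evec_concentrated[OF \<mu>(2)]
      by (intro set_nn_integral_superset) (auto simp: fin_vec_def finite_radon_def)
  qed
  finally show ?thesis .
qed

end

section \<open>Equality of the infima and the solvability criterion\<close>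

theorem theorem7p2:
  fixes \<kappa> :: "'a::t2_space \<Rightarrow> 'a \<Rightarrow> ennreal"
    and h :: real
    and Ipos Ineg :: "nat set"
    and A :: "nat \<Rightarrow> 'a set"
    and chi :: "'a measure \<times> 'a measure"
    and g :: "'a \<Rightarrow> real"
    and a :: "nat \<Rightarrow> real"
    and lamt :: "nat \<Rightarrow> 'a measure"
  assumes X_lc: "locally_compact_space (euclidean :: 'a topology)"
    and X_noncompact: "\<not> compact (UNIV :: 'a set)"
    and k_lsc: "kernel_lsc \<kappa>"
    and k_sym: "kernel_symmetric \<kappa>"
    and k_a: "strictly_pos_def \<kappa>"
    and k_b: "consistent_kernel \<kappa>"
    and k_c: "kernel_offdiag_cont \<kappa>"
    and k_d: "kernel_vanish_infty \<kappa>"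
    and h_ge: "h \<ge> 1"
    and k_e: "gen_max_principle \<kappa> h"
    and cond: "condenser \<kappa> Ipos Ineg A"
    and chi_E: "chi \<in> Ecal \<kappa>"
    and chi_bdd: "bounded_signed chi"
    and chi_pos: "support (fst chi) \<inter> (\<Union>j\<in>Ineg. A j) = {}"
    and chi_neg: "support (snd chi) \<inter> (\<Union>i\<in>Ipos. A i) = {}"
    and g_cont: "continuous_on (\<Union>i\<in>Ipos \<union> Ineg. A i) g"
    and g_inf: "\<exists>c>0. \<forall>x\<in>(\<Union>i\<in>Ipos \<union> Ineg. A i). c \<le> g x"
    and g_growth: "\<forall>i\<in>Ipos \<union> Ineg. bounded (g ` A i) \<or>
        (\<exists>r>1. \<exists>\<nu>\<in>Ecal \<kappa>. nearly_everywhere \<kappa> (A i) (\<lambda>x.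
            (pot \<kappa> (fst \<nu>) x \<noteq> \<infinity> \<or> pot \<kappa> (snd \<nu>) x \<noteq> \<infinity>) \<and>
            ereal (g x powr r) \<le> enn2ereal (pot \<kappa> (fst \<nu>) x) - enn2ereal (pot \<kappa> (snd \<nu>) x)))"
    and a_pos: "\<forall>i\<in>Ipos \<union> Ineg. a i > 0"
    and a_sum: "summable (\<lambda>i. if i \<in> Ipos \<union> Ineg then a i else 0)"
    and G_fin: "Ginf \<kappa> Ipos Ineg A a g chi (Ipos \<union> Ineg) < \<infinity>"
    and L_ne: "{l\<in>Ipos \<union> Ineg. capacity \<kappa> (A l) = \<infinity>} \<noteq> {}"
    and L_sub: "{l\<in>Ipos \<union> Ineg. capacity \<kappa> (A l) = \<infinity>} \<subseteq> Ineg"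
    and sol: "is_solution \<kappa> Ipos Ineg A a g chi (Ipos \<union> Ineg - {l\<in>Ipos \<union> Ineg. capacity \<kappa> (A l) = \<infinity>}) lamt"
    and a_ge: "\<forall>l\<in>{l\<in>Ipos \<union> Ineg. capacity \<kappa> (A l) = \<infinity>}.
        ennreal (a l) \<ge> (\<integral>\<^sup>+ x\<in>A l. ennreal (g x) \<partial>lamt l)"
  shows "Ginf \<kappa> Ipos Ineg A a g chi (Ipos \<union> Ineg)
           = Ginf \<kappa> Ipos Ineg A a g chi (Ipos \<union> Ineg - {l\<in>Ipos \<union> Ineg. capacity \<kappa> (A l) = \<infinity>})
         \<and> ((\<exists>lam. is_solution \<kappa> Ipos Ineg A a g chi (Ipos \<union> Ineg) lam) \<longleftrightarrow>
            (\<forall>l\<in>{l\<in>Ipos \<union> Ineg. capacity \<kappa> (A l) = \<infinity>}.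
               (\<integral>\<^sup>+ x\<in>A l. ennreal (g x) \<partial>lamt l) = ennreal (a l)))"
proof -
  let ?I = "Ipos \<union> Ineg"
  define L where "L = {l\<in>?I. capacity \<kappa> (A l) = \<infinity>}"
  obtain c where c: "0 < c" "\<And>x. x \<in> (\<Union>i\<in>?I. A i) \<Longrightarrow> c \<le> g x" using g_inf by blast
  interpret pd_kernel \<kappa> by unfold_locales (fact k_lsc k_a)+
  \<comment> \<open>If this were infinite, well-definedness would make \<open>sen_neg\<close> finite
    and the energy of \<open>chi\<close> infinite. Hence both parts of \<open>chi\<close> have
    finite energy.\<close>
  have "sen_pos \<kappa> chi < \<infinity>"
  proof (rule ccontr)
    assume "\<not> sen_pos \<kappa> chi < \<infinity>"
    then have "sen_pos \<kappa> chi = top" by (simp add: not_less top_unique)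
    moreover have "sen_neg \<kappa> chi < top"
      using chi_E calculation by (auto simp: Ecal_def energy_wd_def)
    ultimately have "senergy \<kappa> chi = \<infinity>"
      by (cases "sen_neg \<kappa> chi") (auto simp: senergy_def enn2ereal_ennreal)
    then show False using chi_E by (auto simp: Ecal_def)
  qed
  then have chi_fe: "fin_energy (fst chi)" "fin_energy (snd chi)"
    using chi_E chi_bdd
    by (auto simp: Ecal_def signed_radon_def bounded_signed_def sen_pos_def fin_energy_def finite_radon_def)
  interpret gauss_problem \<kappa> Ipos Ineg A chi g a c
    using cond chi_fe g_cont c a_pos a_sum by unfold_locales (auto simp: condenser_def less_imp_le)
  have L: "L \<subseteq> Ineg" "L \<subseteq> ?I" "\<And>l. l \<in> L \<Longrightarrow> capacity \<kappa> (A l) = \<infinity>" using L_sub by (auto simp: L_def)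
  have lamt_adm: "lamt \<in> Eadm \<kappa> Ipos Ineg A a g (?I - L)"
    and lamt_min: "ereal (Gchi \<kappa> Ipos Ineg chi lamt) = Ginf \<kappa> Ipos Ineg A a g chi (?I - L)"
    using sol unfolding is_solution_def L_def by auto
  have ev: "lamt \<in> Evec \<kappa> Ipos Ineg A" and eq: "\<And>i. i \<in> ?I - L \<Longrightarrow> charge (lamt i) i = ennreal (a i)"
    using lamt_adm unfolding Eadm_def by blast+
  have le: "charge (lamt l) l \<le> ennreal (a l)" if "l \<in> L" for l
    using a_ge that unfolding L_def by blast
  have sub: "Eadm \<kappa> Ipos Ineg A a g ?I \<subseteq> Eadm \<kappa> Ipos Ineg A a g (?I - L)"
    unfolding Eadm_def by blast
  have G: "Ginf \<kappa> Ipos Ineg A a g chi ?I = Ginf \<kappa> Ipos Ineg A a g chi (?I - L)"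
  proof (rule antisym)
    show "Ginf \<kappa> Ipos Ineg A a g chi ?I \<le> Ginf \<kappa> Ipos Ineg A a g chi (?I - L)"
      unfolding lamt_min[symmetric] by (rule Ginf_infinite_capacity_le[OF L(1,3) ev eq le])
    show "Ginf \<kappa> Ipos Ineg A a g chi (?I - L) \<le> Ginf \<kappa> Ipos Ineg A a g chi ?I"
      unfolding Ginf_def using sub by (rule INF_superset_mono) simp
  qed
  have "charge (lamt l) l = ennreal (a l)"
    if lam: "is_solution \<kappa> Ipos Ineg A a g chi ?I lam" and l: "l \<in> L" for lam l
  proof -
    have adm: "lam \<in> Eadm \<kappa> Ipos Ineg A a g ?I" using lam by (simp add: is_solution_def)
    have lam_ev: "lam \<in> Evec \<kappa> Ipos Ineg A" and lam_eq: "\<And>i. i \<in> ?I \<Longrightarrow> charge (lam i) i = ennreal (a i)"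
      using adm unfolding Eadm_def by blast+
    have lam_fv: "fin_vec ?I lam" using lam_ev lam_eq by (intro fin_vec_charges) auto
    have lamt_le: "charge (lamt i) i \<le> ennreal (a i)" if "i \<in> ?I" for i
      using eq[of i] le[of i] that by (cases "i \<in> L") auto
    have lamt_fv: "fin_vec ?I lamt" using ev lamt_le by (intro fin_vec_charges)
    \<comment> \<open>A solution of the full problem lies in the larger class and attains its
      infimum, the two infima being equal.\<close>
    have "is_solution \<kappa> Ipos Ineg A a g chi (?I - L) lam"
      using lam sub G unfolding is_solution_def by auto
    moreover have "is_solution \<kappa> Ipos Ineg A a g chi (?I - L) lamt"
      using lamt_adm lamt_min by (simp add: is_solution_def)
    ultimately have "sum_measure lam Ineg = sum_measure lamt Ineg"
      by (rule minimizer_negative_part_unique[OF _ _ lam_fv lamt_fv]) auto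
    then have sums: "(\<Sum>i. if i \<in> Ineg then charge (lam i) i else 0) = (\<Sum>i. if i \<in> Ineg then charge (lamt i) i else 0)"
      using suminf_negative_charges[OF lam_fv lam_ev] suminf_negative_charges[OF lamt_fv ev] by simp
    have "(\<Sum>i. if i \<in> Ineg then charge (lamt i) i else 0) \<le> (\<Sum>i. if i \<in> ?I then ennreal (a i) else 0)"
      using lamt_le by (intro suminf_le) auto
    also have "\<dots> < \<infinity>" by (rule suminf_a_finite)
    finally have fin: "(\<Sum>i. if i \<in> Ineg then charge (lamt i) i else 0) < \<infinity>" .
    \<comment> \<open>Domination in each term together with equal finite sums leaves only termwise
      equality.\<close>
    have "(if i \<in> Ineg then charge (lamt i) i else 0) \<le> (if i \<in> Ineg then charge (lam i) i else 0)" for i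
      using lamt_le[of i] lam_eq[of i] by auto
    from suminf_ennreal_eq_imp_eq[OF this sums fin, of l]
    have "charge (lam l) l = charge (lamt l) l" using l L by auto
    then show ?thesis using l L lam_eq[of l] by auto
  qed
  \<comment> \<open>Conversely, with all charges attained, \<open>lamt\<close> itself is admissible
    for the full problem and attains the common infimum.\<close>
  moreover have "is_solution \<kappa> Ipos Ineg A a g chi ?I lamt" if "\<And>l. l \<in> L \<Longrightarrow> charge (lamt l) l = ennreal (a l)"
  proof -
    have "charge (lamt i) i = ennreal (a i)" if "i \<in> ?I" for i
      using eq[of i] \<open>\<And>l. l \<in> L \<Longrightarrow> charge (lamt l) l = ennreal (a l)\<close>[of i] that by (cases "i \<in> L") auto
    then have "lamt \<in> Eadm \<kappa> Ipos Ineg A a g ?I" using ev unfolding Eadm_def by blast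
    then show ?thesis using lamt_min G by (simp add: is_solution_def)
  qed
  ultimately show ?thesis unfolding L_def[symmetric] using G by blast
qed

end
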